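(* For each finite set $\Gamma\cup\{\alpha\}$ of outer formulas, $$\Gamma\vdash_{\mathsf{Pr}^{\text{\L}^2}_\triangle}\alpha \ \ \mbox{iff} \ \ \Gamma\vDash_{\mathsf{Pr}^{\text{\L}^2}_\triangle}\alpha.$$
   Context: $\mathsf{Pr}^{\text{\L}^2}_\triangle$ is a two-layered logic. Inner formulas are Belnap--Dunn ($\mathsf{BD}$) formulas over $\neg,\wedge,\vee$; atomic modal formulas are $\mathsf{Pr}\phi$ for inner $\phi$ (no nesting); outer formulas are built from these by $\neg,\rightarrow,{\sim},\triangle$ of the logic $\text{\L}^2$ (\L{}ukasiewicz logic with Baaz delta expanded by a De Morgan negation $\neg$, interpreted on $[0,1]\times[0,1]$ with $(a_1,a_2)\rightarrow(b_1,b_2)=(\min\{1,1-a_1+b_1\},\max\{0,b_2-a_2\})$, ${\sim}(a_1,a_2)=(1-a_1,1-a_2)$, $\neg(a_1,a_2)=(a_2,a_1)$, $\triangle(a_1,a_2)=(\triangle_{\text{\L}}a_1,1-\triangle_{\text{\L}}(1-a_2))$, designated value $(1,0)$; $\oplus$, $\ominus$ defined by $\alpha\oplus\beta\coloneqq{\sim}\alpha\rightarrow\beta$, $\alpha\ominus\beta\coloneqq{\sim}(\alpha\rightarrow\beta)$). Models are probabilistic $\mathsf{BD}$ models $(W,v^+,v^-,\mathtt{p})$, where $v^+,v^-$ assign to each variable sets of states supporting its truth/falsity (extended to $|\phi|^+,|\phi|^-$ by the usual Belnap--Dunn clauses: $\neg$ swaps support of truth and falsity, $\wedge$/$\vee$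 are intersection/union on $|\cdot|^+$ and union/intersection on $|\cdot|^-$) and $\mathtt{p}$ is a classical probability measure on $\mathcal{P}(W)$; $v^{\mathscr{M}}(\mathsf{Pr}\phi)=(\mathtt{p}(|\phi|^+),\mathtt{p}(|\phi|^-))$, extended to outer formulas by the $\text{\L}^2$ operations. $\Gamma\vDash\alpha$ iff in every model where all of $\Gamma$ get value $(1,0)$, $\alpha$ gets $(1,0)$. The calculus consists of: the $\mathsf{BD}$ axiomatisation for inner formulas; modal axioms $\mathsf{Pr}\varphi\rightarrow\mathsf{Pr}\psi$ whenever $\varphi\vdash_{\mathsf{BD}}\psi$, $\mathsf{Pr}\neg\varphi\leftrightarrow\neg\mathsf{Pr}\varphi$, and $\mathsf{Pr}(\varphi\vee\psi)\leftrightarrow(\mathsf{Pr}\varphi\ominus\mathsf{Pr}(\varphi\wedge\psi))\oplus\mathsf{Pr}\psi$; and the axioms and rules (MP, $\triangle$-necessitation, conflation $\alpha\vdash{\sim}\neg\alpha$) of $\text{\L}^2$ applied to outer formulas. *)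

theory Defs
  imports "HOL-Probability.Probability" "HOL-Library.Infinite_Typeclass"
begin

section \<open>Belnap--Dunn logic (inner layer)\<close>

datatype 'p bd = BVar 'p | BNeg "'p bd" | BAnd "'p bd" "'p bd" | BOr "'p bd" "'p bd"

text \<open>Supports of truth and of falsity in the frame given by \<open>vp\<close> (\<open>v\<^sup>+\<close>) and \<open>vm\<close> (\<open>v\<^sup>-\<close>).\<close>

fun supp_pos :: "('p \<Rightarrow> 'w set) \<Rightarrow> ('p \<Rightarrow> 'w set) \<Rightarrow> 'p bd \<Rightarrow> 'w set"
  and supp_neg :: "('p \<Rightarrow> 'w set) \<Rightarrow> ('p \<Rightarrow> 'w set) \<Rightarrow> 'p bd \<Rightarrow> 'w set"
where
  "supp_pos vp vm (BVar x) = vp x"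
| "supp_pos vp vm (BNeg \<phi>) = supp_neg vp vm \<phi>"
| "supp_pos vp vm (BAnd \<phi> \<psi>) = supp_pos vp vm \<phi> \<inter> supp_pos vp vm \<psi>"
| "supp_pos vp vm (BOr \<phi> \<psi>) = supp_pos vp vm \<phi> \<union> supp_pos vp vm \<psi>"
| "supp_neg vp vm (BVar x) = vm x"
| "supp_neg vp vm (BNeg \<phi>) = supp_pos vp vm \<phi>"
| "supp_neg vp vm (BAnd \<phi> \<psi>) = supp_neg vp vm \<phi> \<union> supp_neg vp vm \<psi>"
| "supp_neg vp vm (BOr \<phi> \<psi>) = supp_neg vp vm \<phi> \<inter> supp_neg vp vm \<psi>"

inductive bd_derives :: "'p bd \<Rightarrow> 'p bd \<Rightarrow> bool" (infix "\<turnstile>\<^sub>B\<^sub>D" 50) where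
  conjE1: "BAnd \<phi> \<psi> \<turnstile>\<^sub>B\<^sub>D \<phi>"
| conjE2: "BAnd \<phi> \<psi> \<turnstile>\<^sub>B\<^sub>D \<psi>"
| disjI1: "\<phi> \<turnstile>\<^sub>B\<^sub>D BOr \<phi> \<psi>"
| disjI2: "\<psi> \<turnstile>\<^sub>B\<^sub>D BOr \<phi> \<psi>"
| distrib: "BAnd \<phi> (BOr \<psi> \<theta>) \<turnstile>\<^sub>B\<^sub>D BOr (BAnd \<phi> \<psi>) (BAnd \<phi> \<theta>)"
| dnegI: "\<phi> \<turnstile>\<^sub>B\<^sub>D BNeg (BNeg \<phi>)"
| dnegE: "BNeg (BNeg \<phi>) \<turnstile>\<^sub>B\<^sub>D \<phi>"
| deMorgan_disj: "BAnd (BNeg \<phi>) (BNeg \<psi>) \<turnstile>\<^sub>B\<^sub>D BNeg (BOr \<phi> \<psi>)"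
| deMorgan_conj: "BNeg (BAnd \<phi> \<psi>) \<turnstile>\<^sub>B\<^sub>D BOr (BNeg \<phi>) (BNeg \<psi>)"
| cut: "\<phi> \<turnstile>\<^sub>B\<^sub>D \<psi> \<Longrightarrow> \<psi> \<turnstile>\<^sub>B\<^sub>D \<theta> \<Longrightarrow> \<phi> \<turnstile>\<^sub>B\<^sub>D \<theta>"
| conjI: "\<phi> \<turnstile>\<^sub>B\<^sub>D \<psi> \<Longrightarrow> \<phi> \<turnstile>\<^sub>B\<^sub>D \<theta> \<Longrightarrow> \<phi> \<turnstile>\<^sub>B\<^sub>D BAnd \<psi> \<theta>"
| disjE: "\<phi> \<turnstile>\<^sub>B\<^sub>D \<theta> \<Longrightarrow> \<psi> \<turnstile>\<^sub>B\<^sub>D \<theta> \<Longrightarrow> BOr \<phi> \<psi> \<turnstile>\<^sub>B\<^sub>D \<theta>"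
| contrapos: "\<phi> \<turnstile>\<^sub>B\<^sub>D \<psi> \<Longrightarrow> BNeg \<psi> \<turnstile>\<^sub>B\<^sub>D BNeg \<phi>"


section \<open>Outer formulas\<close>

datatype 'p outer =
    Pr "'p bd"
  | ONeg "'p outer"  ("\<^bold>\<not> _" [70] 70)
  | OImp "'p outer" "'p outer"  (infixr "\<^bold>\<rightarrow>" 55)
  | OTilde "'p outer"  ("\<^bold>\<sim> _" [70] 70)
  | ODelta "'p outer"  ("\<^bold>\<triangle> _" [70] 70)

abbreviation OOr :: "'p outer \<Rightarrow> 'p outer \<Rightarrow> 'p outer" (infixr "\<^bold>\<or>" 60)
  where "\<alpha> \<^bold>\<or> \<beta> \<equiv> (\<alpha> \<^bold>\<rightarrow> \<beta>) \<^bold>\<rightarrow> \<beta>"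

abbreviation OOplus :: "'p outer \<Rightarrow> 'p outer \<Rightarrow> 'p outer" (infixl "\<^bold>\<oplus>" 65)
  where "\<alpha> \<^bold>\<oplus> \<beta> \<equiv> \<^bold>\<sim> \<alpha> \<^bold>\<rightarrow> \<beta>"

abbreviation OOminus :: "'p outer \<Rightarrow> 'p outer \<Rightarrow> 'p outer" (infixl "\<^bold>\<ominus>" 65)
  where "\<alpha> \<^bold>\<ominus> \<beta> \<equiv> \<^bold>\<sim> (\<alpha> \<^bold>\<rightarrow> \<beta>)"

abbreviation OOdot :: "'p outer \<Rightarrow> 'p outer \<Rightarrow> 'p outer" (infixl "\<^bold>\<odot>" 65)
  where "\<alpha> \<^bold>\<odot> \<beta> \<equiv> \<^bold>\<sim> (\<alpha> \<^bold>\<rightarrow> \<^bold>\<sim> \<beta>)"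

abbreviation OIff :: "'p outer \<Rightarrow> 'p outer \<Rightarrow> 'p outer" (infix "\<^bold>\<leftrightarrow>" 52)
  where "\<alpha> \<^bold>\<leftrightarrow> \<beta> \<equiv> (\<alpha> \<^bold>\<rightarrow> \<beta>) \<^bold>\<odot> (\<beta> \<^bold>\<rightarrow> \<alpha>)"


section \<open>Semantics\<close>

definition delta_L :: "real \<Rightarrow> real" where
  "delta_L a = (if a = 1 then 1 else 0)"

fun L2_imp :: "real \<times> real \<Rightarrow> real \<times> real \<Rightarrow> real \<times> real" where
  "L2_imp (a1, a2) (b1, b2) = (min 1 (1 - a1 + b1), max 0 (b2 - a2))"

fun L2_tilde :: "real \<times> real \<Rightarrow> real \<times> real" where
  "L2_tilde (a1, a2) = (1 - a1, 1 - a2)"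

fun L2_neg :: "real \<times> real \<Rightarrow> real \<times> real" where
  "L2_neg (a1, a2) = (a2, a1)"

fun L2_delta :: "real \<times> real \<Rightarrow> real \<times> real" where
  "L2_delta (a1, a2) = (delta_L a1, 1 - delta_L (1 - a2))"

text \<open>Nonemptiness of \<open>W\<close> is implied by \<open>prob_space P\<close>.\<close>

definition prob_bd_model ::
  "'w set \<Rightarrow> ('p \<Rightarrow> 'w set) \<Rightarrow> ('p \<Rightarrow> 'w set) \<Rightarrow> 'w measure \<Rightarrow> bool" where
  "prob_bd_model W vp vm P \<longleftrightarrow>
     (\<forall>x. vp x \<subseteq> W) \<and> (\<forall>x. vm x \<subseteq> W) \<and>
     prob_space P \<and> space P = W \<and> sets P = Pow W"

primrec outer_val ::
  "('p \<Rightarrow> 'w set) \<Rightarrow> ('p \<Rightarrow> 'w set) \<Rightarrow> 'w measure \<Rightarrow> 'p outer \<Rightarrow> real \<times> real" where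
  "outer_val vp vm P (Pr \<phi>) =
     (measure P (supp_pos vp vm \<phi>), measure P (supp_neg vp vm \<phi>))"
| "outer_val vp vm P (\<^bold>\<not> \<alpha>) = L2_neg (outer_val vp vm P \<alpha>)"
| "outer_val vp vm P (\<alpha> \<^bold>\<rightarrow> \<beta>) = L2_imp (outer_val vp vm P \<alpha>) (outer_val vp vm P \<beta>)"
| "outer_val vp vm P (\<^bold>\<sim> \<alpha>) = L2_tilde (outer_val vp vm P \<alpha>)"
| "outer_val vp vm P (\<^bold>\<triangle> \<alpha>) = L2_delta (outer_val vp vm P \<alpha>)"

text \<open>
  HOL cannot quantify over all types inside a formula, so the type \<open>'w\<close> from which states are
  drawn is a parameter.  The carrier \<open>W\<close> of a model is an arbitrary nonempty set over \<open>'w\<close>.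
  With \<open>'w\<close> of class \<open>infinite\<close> all models with finitely many states are included up to
  isomorphism; over a finite \<open>'w\<close> the size of \<open>W\<close> would be bounded.
\<close>

definition pr_entails :: "'w itself \<Rightarrow> 'p outer set \<Rightarrow> 'p outer \<Rightarrow> bool" where
  "pr_entails (_ :: 'w itself) \<Gamma> \<alpha> \<longleftrightarrow>
     (\<forall>(W :: 'w set) vp vm P. prob_bd_model W vp vm P \<longrightarrow>
        (\<forall>\<gamma>\<in>\<Gamma>. outer_val vp vm P \<gamma> = (1, 0)) \<longrightarrow> outer_val vp vm P \<alpha> = (1, 0))"


section \<open>The calculus\<close>

text \<open>
  \<open>w\<close>--\<open>co\<close> axiomatise Lukasiewicz logic, \<open>delta1\<close>--\<open>delta5\<close> Baaz delta, and \<open>neg\<close>--\<open>deM_delta\<close>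
  the De Morgan negation.
\<close>

inductive L2_axiom :: "'p outer \<Rightarrow> bool" where
  w: "L2_axiom (\<alpha> \<^bold>\<rightarrow> (\<beta> \<^bold>\<rightarrow> \<alpha>))"
| sf: "L2_axiom ((\<alpha> \<^bold>\<rightarrow> \<beta>) \<^bold>\<rightarrow> ((\<beta> \<^bold>\<rightarrow> \<theta>) \<^bold>\<rightarrow> (\<alpha> \<^bold>\<rightarrow> \<theta>)))"
| waj: "L2_axiom (((\<alpha> \<^bold>\<rightarrow> \<beta>) \<^bold>\<rightarrow> \<beta>) \<^bold>\<rightarrow> ((\<beta> \<^bold>\<rightarrow> \<alpha>) \<^bold>\<rightarrow> \<alpha>))"
| co: "L2_axiom ((\<^bold>\<sim> \<beta> \<^bold>\<rightarrow> \<^bold>\<sim> \<alpha>) \<^bold>\<rightarrow> (\<alpha> \<^bold>\<rightarrow> \<beta>))"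
| delta1: "L2_axiom (\<^bold>\<triangle> \<alpha> \<^bold>\<or> \<^bold>\<sim> \<^bold>\<triangle> \<alpha>)"
| delta2: "L2_axiom (\<^bold>\<triangle> \<alpha> \<^bold>\<rightarrow> \<alpha>)"
| delta3: "L2_axiom (\<^bold>\<triangle> \<alpha> \<^bold>\<rightarrow> \<^bold>\<triangle> \<^bold>\<triangle> \<alpha>)"
| delta4: "L2_axiom (\<^bold>\<triangle> (\<alpha> \<^bold>\<or> \<beta>) \<^bold>\<rightarrow> (\<^bold>\<triangle> \<alpha> \<^bold>\<or> \<^bold>\<triangle> \<beta>))"
| delta5: "L2_axiom (\<^bold>\<triangle> (\<alpha> \<^bold>\<rightarrow> \<beta>) \<^bold>\<rightarrow> (\<^bold>\<triangle> \<alpha> \<^bold>\<rightarrow> \<^bold>\<triangle> \<beta>))"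
| neg: "L2_axiom (\<^bold>\<not> \<^bold>\<not> \<alpha> \<^bold>\<leftrightarrow> \<alpha>)"
| deM_tilde: "L2_axiom (\<^bold>\<not> \<^bold>\<sim> \<alpha> \<^bold>\<leftrightarrow> \<^bold>\<sim> \<^bold>\<not> \<alpha>)"
| deM_imp: "L2_axiom ((\<^bold>\<sim> \<^bold>\<not> \<alpha> \<^bold>\<rightarrow> \<^bold>\<sim> \<^bold>\<not> \<beta>) \<^bold>\<leftrightarrow> \<^bold>\<sim> \<^bold>\<not> (\<alpha> \<^bold>\<rightarrow> \<beta>))"
| deM_delta: "L2_axiom (\<^bold>\<not> \<^bold>\<triangle> \<alpha> \<^bold>\<leftrightarrow> \<^bold>\<sim> \<^bold>\<triangle> \<^bold>\<sim> \<^bold>\<not> \<alpha>)"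

inductive modal_axiom :: "'p outer \<Rightarrow> bool" where
  mono: "\<phi> \<turnstile>\<^sub>B\<^sub>D \<psi> \<Longrightarrow> modal_axiom (Pr \<phi> \<^bold>\<rightarrow> Pr \<psi>)"
| neg: "modal_axiom (Pr (BNeg \<phi>) \<^bold>\<leftrightarrow> \<^bold>\<not> Pr \<phi>)"
| incl_excl: "modal_axiom (Pr (BOr \<phi> \<psi>) \<^bold>\<leftrightarrow> ((Pr \<phi> \<^bold>\<ominus> Pr (BAnd \<phi> \<psi>)) \<^bold>\<oplus> Pr \<psi>))"

inductive pr_derives :: "'p outer set \<Rightarrow> 'p outer \<Rightarrow> bool" for \<Gamma> :: "'p outer set" where
  premise: "\<alpha> \<in> \<Gamma> \<Longrightarrow> pr_derives \<Gamma> \<alpha>"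
| L2: "L2_axiom \<alpha> \<Longrightarrow> pr_derives \<Gamma> \<alpha>"
| modal: "modal_axiom \<alpha> \<Longrightarrow> pr_derives \<Gamma> \<alpha>"
| mp: "pr_derives \<Gamma> \<alpha> \<Longrightarrow> pr_derives \<Gamma> (\<alpha> \<^bold>\<rightarrow> \<beta>) \<Longrightarrow> pr_derives \<Gamma> \<beta>"
| nec: "pr_derives \<Gamma> \<alpha> \<Longrightarrow> pr_derives \<Gamma> (\<^bold>\<triangle> \<alpha>)"
| conf: "pr_derives \<Gamma> \<alpha> \<Longrightarrow> pr_derives \<Gamma> (\<^bold>\<sim> \<^bold>\<not> \<alpha>)"

end

theory Submission
  imports Defs
begin

text \<open>
  Completeness. Conflation \<open>\<sim>\<not>\<close> exchanges \<open>a\<^sub>1\<close> and \<open>1 - a\<^sub>2\<close> in a value and commutes with the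
  Lukasiewicz connectives, so it suffices to evaluate \<open>\<alpha>\<close> and \<open>\<sim>\<not>\<alpha>\<close> in one-dimensional
  Lukasiewicz logic with Baaz delta. If \<open>\<alpha>\<close> is not derivable, the set of derivable formulas extends to a
  set without \<open>\<alpha>\<close> that is closed under modus ponens and necessitation and whose Lindenbaum algebra is a
  chain. Finitely many elements of such a chain embed into \<open>[0,1]\<close>: the chain acts by order-preserving
  commuting translations on Chang's ordered group, and Fourier--Motzkin elimination solves in the reals
  every finite system of linear conditions that these translations satisfy. Since there are finitely many
  Belnap--Dunn formulas over finitely many variables up to equivalence, finitely many instances of the
  modal axioms make the real values of \<open>Pr \<phi>\<close> monotone and modular, and Moebius inversion over sets of
  literals turns them into a probability measure.
\<close>

section \<open>Lukasiewicz theories\<close>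

text \<open>Linearity and closure under conflation do not go together. In a theory closed under
  conflation, \<beta> \<rightarrow> \<sim>\<not>\<beta> yields \<sim>\<not>\<beta> \<rightarrow>
  \<beta> and vice versa, since conflation is an involution; a linear one would therefore make every
  formula equivalent to its conflation and force a2 = 1 - a1. So the set that is made linear drops
  this rule. It merely inherits from the derivable formulas that premises and modal axioms occur
  together with their conflations, which is what the second components require. The chain may
  contain infinitesimals, so a global embedding into the reals cannot be expected. Hence all
  relevant formulas and axiom instances are collected in a finite set before any real value is
  chosen. Strict inequalities have to survive this choice, because the underivable formula must end
  up strictly below 1; this is why the elimination records which inequalities are strict.\<close>

locale lukasiewicz_theory =
  fixes imp :: "'a \<Rightarrow> 'a \<Rightarrow> 'a" (infixr "\<leadsto>" 60)
    and neg :: "'a \<Rightarrow> 'a" ("\<sim> _" [90] 90)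
    and T :: "'a set"
  assumes weakening: "x \<leadsto> (y \<leadsto> x) \<in> T"
    and suffixing: "(x \<leadsto> y) \<leadsto> ((y \<leadsto> z) \<leadsto> (x \<leadsto> z)) \<in> T"
    and wajsberg: "((x \<leadsto> y) \<leadsto> y) \<leadsto> ((y \<leadsto> x) \<leadsto> x) \<in> T"
    and contraposition: "(\<sim> y \<leadsto> \<sim> x) \<leadsto> (x \<leadsto> y) \<in> T"
    and detachment: "x \<in> T \<Longrightarrow> x \<leadsto> y \<in> T \<Longrightarrow> y \<in> T"
begin

text \<open>The Lindenbaum algebra is not formed as a quotient: this is only a preorder on formulas,
  members of \<open>T\<close> are its top elements, and each MV-algebra equation appears below as a
  pair of inequalities.\<close>

definition le (infix "\<sqsubseteq>" 50) where "x \<sqsubseteq> y \<longleftrightarrow> x \<leadsto> y \<in> T"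

lemma ax_w: "x \<sqsubseteq> y \<leadsto> x"
  and ax_sf: "x \<leadsto> y \<sqsubseteq> (y \<leadsto> z) \<leadsto> (x \<leadsto> z)"
  and ax_waj: "(x \<leadsto> y) \<leadsto> y \<sqsubseteq> (y \<leadsto> x) \<leadsto> x"
  and ax_co: "\<sim> y \<leadsto> \<sim> x \<sqsubseteq> x \<leadsto> y"
  unfolding le_def by (rule weakening suffixing wajsberg contraposition)+

lemma mem_mp: "x \<in> T \<Longrightarrow> x \<sqsubseteq> y \<Longrightarrow> y \<in> T"
  unfolding le_def by (rule detachment)

text \<open>Lets an axiom whose two sides are implications act as a rule about
  \<sqsubseteq>.\<close>

lemma le_mp: "x \<sqsubseteq> y \<Longrightarrow> x \<leadsto> y \<sqsubseteq> u \<leadsto> v \<Longrightarrow> u \<sqsubseteq> v"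
  unfolding le_def by (rule detachment)

abbreviation odot (infixr "\<odot>" 70) where "x \<odot> y \<equiv> \<sim> (x \<leadsto> \<sim> y)"

lemma imp_anti: "x \<sqsubseteq> y \<Longrightarrow> y \<leadsto> z \<sqsubseteq> x \<leadsto> z"
  using mem_mp[OF _ ax_sf] unfolding le_def .

lemma le_trans [trans]: "x \<sqsubseteq> y \<Longrightarrow> y \<sqsubseteq> z \<Longrightarrow> x \<sqsubseteq> z"
  by (rule le_mp[OF _ imp_anti])

lemma le_top: "x \<in> T \<Longrightarrow> y \<sqsubseteq> x"
  using mem_mp[OF _ ax_w] unfolding le_def .

lemma le_imp_imp: "x \<sqsubseteq> (x \<leadsto> y) \<leadsto> y"
  by (rule le_trans[OF ax_w ax_waj])

text \<open>Suffixing leads to ((y \<leadsto> z) \<leadsto> z) \<leadsto> (x \<leadsto> z), and y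
  lies below that antecedent.\<close>

lemma exchange: "x \<leadsto> (y \<leadsto> z) \<sqsubseteq> y \<leadsto> (x \<leadsto> z)"
  by (rule le_trans[OF ax_sf imp_anti[OF le_imp_imp]])

text \<open>Weakening followed by exchange puts every y below x \<leadsto> x; taking for y an
  instance of weakening, which is in \<open>T\<close>, puts x \<leadsto> x into
  \<open>T\<close>.\<close>

lemma le_refl: "x \<sqsubseteq> x"
  using mem_mp[OF weakening le_mp[OF ax_w exchange]] unfolding le_def .

lemma imp_mono: "y \<sqsubseteq> z \<Longrightarrow> x \<leadsto> y \<sqsubseteq> x \<leadsto> z"
  by (rule le_mp[OF _ le_mp[OF ax_sf exchange]])

lemma top_imp: "x \<in> T \<Longrightarrow> x \<leadsto> y \<sqsubseteq> y"
  using mem_mp[OF _ le_imp_imp] unfolding le_def .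

lemma top_imp': "x \<sqsubseteq> y \<Longrightarrow> (x \<leadsto> y) \<leadsto> z \<sqsubseteq> z"
  using top_imp le_def by blast

lemma neg_imp: "\<sim> x \<sqsubseteq> x \<leadsto> y"
  by (rule le_trans[OF ax_w ax_co])

lemma dneg_le: "\<sim> \<sim> x \<sqsubseteq> x"
proof -
  \<comment> \<open>Ex falso with the conclusion \<sim> (x \<leadsto> x), so that contraposition
    leaves the theorem x \<leadsto> x as an antecedent that can be discharged.\<close>
  have "\<sim> \<sim> x \<sqsubseteq> (x \<leadsto> x) \<leadsto> x"
    by (rule le_trans[OF neg_imp ax_co])
  also have "\<dots> \<sqsubseteq> x" by (rule top_imp'[OF le_refl])
  finally show ?thesis .
qed

lemma le_dneg: "x \<sqsubseteq> \<sim> \<sim> x"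
  by (rule le_mp[OF dneg_le ax_co])

lemma contrapos_le: "x \<leadsto> y \<sqsubseteq> \<sim> y \<leadsto> \<sim> x"
proof -
  have "x \<leadsto> y \<sqsubseteq> \<sim> \<sim> x \<leadsto> y" by (rule imp_anti[OF dneg_le])
  also have "\<dots> \<sqsubseteq> \<sim> \<sim> x \<leadsto> \<sim> \<sim> y" by (rule imp_mono[OF le_dneg])
  also have "\<dots> \<sqsubseteq> \<sim> y \<leadsto> \<sim> x" by (rule ax_co)
  finally show ?thesis .
qed

lemma neg_anti: "x \<sqsubseteq> y \<Longrightarrow> \<sim> y \<sqsubseteq> \<sim> x"
  by (rule le_mp[OF _ contrapos_le])

lemma neg_antiD: "\<sim> y \<sqsubseteq> \<sim> x \<Longrightarrow> x \<sqsubseteq> y"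
  by (rule le_mp[OF _ ax_co])

lemma imp_neg_swap: "x \<leadsto> \<sim> y \<sqsubseteq> y \<leadsto> \<sim> x"
  by (rule le_trans[OF contrapos_le imp_anti[OF le_dneg]])

lemma neg_imp_swap: "\<sim> x \<leadsto> y \<sqsubseteq> \<sim> y \<leadsto> x"
  by (rule le_trans[OF contrapos_le imp_mono[OF dneg_le]])

lemma odot_comm: "x \<odot> y \<sqsubseteq> y \<odot> x"
  by (rule neg_anti[OF imp_neg_swap])

lemma curry_le: "(x \<odot> y) \<leadsto> z \<sqsubseteq> x \<leadsto> (y \<leadsto> z)"
proof -
  have "(x \<odot> y) \<leadsto> z \<sqsubseteq> \<sim> z \<leadsto> (x \<leadsto> \<sim> y)" by (rule neg_imp_swap)
  also have "\<dots> \<sqsubseteq> x \<leadsto> (\<sim> z \<leadsto> \<sim> y)" by (rule exchange)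
  also have "\<dots> \<sqsubseteq> x \<leadsto> (y \<leadsto> z)" by (rule imp_mono[OF ax_co])
  finally show ?thesis .
qed

lemma uncurry_le: "x \<leadsto> (y \<leadsto> z) \<sqsubseteq> (x \<odot> y) \<leadsto> z"
proof -
  have "x \<leadsto> (y \<leadsto> z) \<sqsubseteq> x \<leadsto> (\<sim> z \<leadsto> \<sim> y)" by (rule imp_mono[OF contrapos_le])
  also have "\<dots> \<sqsubseteq> \<sim> z \<leadsto> (x \<leadsto> \<sim> y)" by (rule exchange)
  also have "\<dots> \<sqsubseteq> (x \<odot> y) \<leadsto> z" by (rule neg_imp_swap)
  finally show ?thesis .
qed

lemma odot_residual: "x \<odot> y \<sqsubseteq> z \<longleftrightarrow> x \<sqsubseteq> y \<leadsto> z"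
  by (rule iffI) (erule le_mp[OF _ curry_le], erule le_mp[OF _ uncurry_le])

lemma odot_mono:
  assumes "x \<sqsubseteq> x'" "y \<sqsubseteq> y'" shows "x \<odot> y \<sqsubseteq> x' \<odot> y'"
  using neg_anti[OF le_trans[OF imp_mono[OF neg_anti[OF assms(2)]] imp_anti[OF assms(1)]]] .

lemma odot_imp: "x \<odot> (x \<leadsto> y) \<sqsubseteq> y"
  by (simp only: odot_residual le_imp_imp)

lemma odot_assoc: "(x \<odot> y) \<odot> z \<sqsubseteq> x \<odot> (y \<odot> z)"
proof -
  have "x \<leadsto> \<sim> (y \<odot> z) \<sqsubseteq> x \<leadsto> (y \<leadsto> \<sim> z)" by (rule imp_mono[OF dneg_le])
  also have "\<dots> \<sqsubseteq> (x \<odot> y) \<leadsto> \<sim> z" by (rule uncurry_le)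
  finally show ?thesis by (rule neg_anti)
qed

lemma odot_assoc': "x \<odot> (y \<odot> z) \<sqsubseteq> (x \<odot> y) \<odot> z"
proof -
  have "(x \<odot> y) \<leadsto> \<sim> z \<sqsubseteq> x \<leadsto> (y \<leadsto> \<sim> z)" by (rule curry_le)
  also have "\<dots> \<sqsubseteq> x \<leadsto> \<sim> (y \<odot> z)" by (rule imp_mono[OF le_dneg])
  finally show ?thesis by (rule neg_anti)
qed

text \<open>In an MV-algebra x \<odot> (x \<leadsto> y) is the meet of x and y. The nontrivial bound
  is Wajsberg's axiom applied to the negations, where the join becomes this meet.\<close>

lemma divisibility: "y \<sqsubseteq> x \<Longrightarrow> y \<sqsubseteq> x \<odot> (x \<leadsto> y)"
proof -
  assume "y \<sqsubseteq> x"
  have "x \<leadsto> \<sim> (x \<leadsto> y) \<sqsubseteq> (x \<leadsto> y) \<leadsto> \<sim> x" by (rule imp_neg_swap)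
  also have "\<dots> \<sqsubseteq> (\<sim> y \<leadsto> \<sim> x) \<leadsto> \<sim> x" by (rule imp_anti[OF ax_co])
  also have "\<dots> \<sqsubseteq> (\<sim> x \<leadsto> \<sim> y) \<leadsto> \<sim> y" by (rule ax_waj)
  also have "\<dots> \<sqsubseteq> \<sim> y" using \<open>y \<sqsubseteq> x\<close> by (intro top_imp' neg_anti)
  finally show ?thesis by (rule le_trans[OF le_dneg neg_anti])
qed

lemma join_least:
  assumes "x \<sqsubseteq> z" "y \<sqsubseteq> z" shows "(x \<leadsto> y) \<leadsto> y \<sqsubseteq> z"
proof -
  have "(x \<leadsto> y) \<leadsto> y \<sqsubseteq> (z \<leadsto> y) \<leadsto> y" by (intro imp_anti assms)
  also have "\<dots> \<sqsubseteq> (y \<leadsto> z) \<leadsto> z" by (rule ax_waj)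
  also have "\<dots> \<sqsubseteq> z" using assms(2) by (rule top_imp')
  finally show ?thesis .
qed

text \<open>As membership in \<open>T\<close> this says that the join of x \<leadsto> y and y
  \<leadsto> x is a theorem, joins being written (a \<leadsto> b) \<leadsto> b. The reason is that y
  splits by divisibility into x \<leadsto> y and the join of x and y, while y \<leadsto> x lies
  below the implication from that join to x.\<close>

lemma prelinear: "(x \<leadsto> y) \<leadsto> (y \<leadsto> x) \<sqsubseteq> y \<leadsto> x"
proof -
  let ?p = "x \<leadsto> y" and ?j = "(x \<leadsto> y) \<leadsto> y"
  have "y \<leadsto> x \<sqsubseteq> ((y \<leadsto> x) \<leadsto> x) \<leadsto> x" by (rule le_imp_imp)
  also have "\<dots> \<sqsubseteq> ?j \<leadsto> x" by (rule imp_anti[OF ax_waj])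
  finally have "?p \<leadsto> (y \<leadsto> x) \<sqsubseteq> ?p \<leadsto> (?j \<leadsto> x)" by (rule imp_mono)
  also have "\<dots> \<sqsubseteq> (?p \<odot> ?j) \<leadsto> x" by (rule uncurry_le)
  also have "\<dots> \<sqsubseteq> y \<leadsto> x" by (rule imp_anti[OF divisibility[OF ax_w]])
  finally show ?thesis .
qed

lemma odot_le1: "x \<odot> y \<sqsubseteq> x"
  by (simp only: odot_residual ax_w)

lemma odot_le2: "x \<odot> y \<sqsubseteq> y"
  by (rule le_trans[OF odot_comm odot_le1])

lemma neg_top_le: "t \<in> T \<Longrightarrow> \<sim> t \<sqsubseteq> x"
  by (rule le_trans[OF neg_imp top_imp])

lemma imp_bot_le: "t \<in> T \<Longrightarrow> x \<leadsto> \<sim> t \<sqsubseteq> \<sim> x"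
  by (rule le_trans[OF imp_neg_swap top_imp])

end

section \<open>Commuting translations of a total preorder\<close>

text \<open>Chooses the eliminated variable. A single t has to serve all bounds and to be strict at
  every bound that no opposite bound meets.\<close>

lemma between_bounds:
  fixes L :: "'k \<Rightarrow> real" and U :: "'l \<Rightarrow> real"
  assumes "finite P" "finite M"
    and "\<And>k l. k \<in> P \<Longrightarrow> l \<in> M \<Longrightarrow> L k \<le> U l"
  obtains t where "\<And>k. k \<in> P \<Longrightarrow> L k \<le> t" "\<And>l. l \<in> M \<Longrightarrow> t \<le> U l"
    "\<And>k. k \<in> P \<Longrightarrow> \<forall>l\<in>M. L k < U l \<Longrightarrow> L k < t"
    "\<And>l. l \<in> M \<Longrightarrow> \<forall>k\<in>P. L k < U l \<Longrightarrow> t < U l"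
proof -
  define A B where "A = L ` P" and "B = U ` M"
  have fin: "finite A" "finite B" using assms by (auto simp: A_def B_def)
  have AB: "a \<le> b" if "a \<in> A" "b \<in> B" for a b using that assms(3) by (auto simp: A_def B_def)
  have "\<exists>t. (\<forall>a\<in>A. a \<le> t \<and> ((\<forall>b\<in>B. a < b) \<longrightarrow> a < t)) \<and>
    (\<forall>b\<in>B. t \<le> b \<and> ((\<forall>a\<in>A. a < b) \<longrightarrow> t < b))"
  proof (cases "A = {} \<or> B = {}")
    case True
    then show ?thesis
    proof
      assume "A = {}"
      moreover have "Min B - 1 \<le> b \<and> Min B - 1 < b" if "b \<in> B" for b
        using Min_le[OF fin(2) that] by linarith
      ultimately show ?thesis using fin by (auto intro!: exI[of _ "Min B - 1"])
    next
      assume "B = {}"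
      moreover have "a \<le> Max A + 1 \<and> a < Max A + 1" if "a \<in> A" for a
        using Max_ge[OF fin(1) that] by linarith
      ultimately show ?thesis using fin by (auto intro!: exI[of _ "Max A + 1"])
    qed
  next
    case False
    then have max: "Max A \<in> A" "Min B \<in> B" using fin by auto
    then have le: "Max A \<le> Min B" using AB by auto
    \<comment> \<open>A lower bound can equal the midpoint only if it equals both
      \<open>Max A\<close> and \<open>Min B\<close>, hence only if it meets an upper bound; dually
      for upper bounds.\<close>
    let ?t = "(Max A + Min B) / 2"
    have "a \<le> ?t \<and> ((\<forall>b\<in>B. a < b) \<longrightarrow> a < ?t)" if "a \<in> A" for a
    proof -
      have "a \<le> Max A" using that fin by auto
      moreover have "a < ?t" if "\<forall>b\<in>B. a < b"
      proof -
        have "a < Min B" using that max by auto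
        then show ?thesis using \<open>a \<le> Max A\<close> le by (simp add: field_simps)
      qed
      ultimately show ?thesis using le by (auto simp: field_simps)
    qed
    moreover have "?t \<le> b \<and> ((\<forall>a\<in>A. a < b) \<longrightarrow> ?t < b)" if "b \<in> B" for b
    proof -
      have "Min B \<le> b" using that fin by auto
      moreover have "?t < b" if "\<forall>a\<in>A. a < b"
      proof -
        have "Max A < b" using that max by auto
        then show ?thesis using \<open>Min B \<le> b\<close> le by (simp add: field_simps)
      qed
      ultimately show ?thesis using le by (auto simp: field_simps)
    qed
    ultimately show ?thesis by blast
  qed
  then obtain t where "\<And>a. a \<in> A \<Longrightarrow> a \<le> t \<and> ((\<forall>b\<in>B. a < b) \<longrightarrow> a < t)"
    "\<And>b. b \<in> B \<Longrightarrow> t \<le> b \<and> ((\<forall>a\<in>A. a < b) \<longrightarrow> t < b)" by blast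
  then show thesis by (intro that[of t]) (simp_all add: A_def B_def)
qed

text \<open>\<open>N\<close> stands for the integer forms known to be non-negative, so k is forced
  to be zero only when -k lies in \<open>N\<close> as well. Elimination multiplies by positive
  integers only, which is why closure under addition is enough.\<close>

lemma fourier_motzkin:
  fixes N :: "('i \<Rightarrow> int) set"
  assumes "finite I" "finite K" "K \<subseteq> N"
    and "\<And>k i. k \<in> K \<Longrightarrow> i \<notin> I \<Longrightarrow> k i = 0"
    and add: "\<And>k l. k \<in> N \<Longrightarrow> l \<in> N \<Longrightarrow> (\<lambda>i. k i + l i) \<in> N"
  shows "\<exists>x :: 'i \<Rightarrow> real. \<forall>k\<in>K. 0 \<le> (\<Sum>i\<in>I. k i * x i) \<and>
    ((\<lambda>i. - k i) \<notin> N \<longrightarrow> 0 < (\<Sum>i\<in>I. k i * x i))"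
  using assms(1-4)
proof (induction I arbitrary: K)
  case empty
  \<comment> \<open>With no index left, k is zero and equals its negative, so no strict inequality
    is demanded.\<close>
  have "(\<lambda>i. - k i) \<in> N" if "k \<in> K" for k
  proof -
    have "k = (\<lambda>i. - k i)" using empty(3)[OF that] by auto
    then show ?thesis using empty(2) that by auto
  qed
  then show ?case by auto
next
  case (insert j I)
  have scale: "(\<lambda>i. int (Suc n) * k i) \<in> N" if "k \<in> N" for n k
  proof (induction n)
    case (Suc n)
    have "(\<lambda>i. int (Suc (Suc n)) * k i) = (\<lambda>i. int (Suc n) * k i + k i)"
      by (simp add: algebra_simps)
    then show ?case using add[OF Suc that] by simp
  qed (use that in simp)
  have scale_pos: "(\<lambda>i. m * k i) \<in> N" if "k \<in> N" "0 < m" for m k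
  proof -
    have "m = int (Suc (nat m - 1))" using that by linarith
    then show ?thesis using scale[OF that(1), of "nat m - 1"] by simp
  qed
  \<comment> \<open>\<open>N\<close> has no division; instead -k is the sum of (m - 1) k and -(m
    k).\<close>
  have root: "(\<lambda>i. - k i) \<in> N" if "k \<in> N" "0 < m" "(\<lambda>i. - (m * k i)) \<in> N" for m k
  proof (cases "m = 1")
    case False
    have "(\<lambda>i. (m - 1) * k i) \<in> N" using that False by (intro scale_pos) auto
    from add[OF this that(3)] show ?thesis by (simp add: algebra_simps)
  qed (use that in simp)
  define P M Z where "P = {k \<in> K. 0 < k j}" and "M = {k \<in> K. k j < 0}" and "Z = {k \<in> K. k j = 0}"
  \<comment> \<open>Cancels coordinate j; both multipliers are positive for k in \<open>P\<close>
    and l in \<open>M\<close>.\<close>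
  define comb where "comb = (\<lambda>(k :: 'i \<Rightarrow> int, l) i. - l j * k i + k j * l i)"
  define K' where "K' = Z \<union> comb ` (P \<times> M)"
  have PN: "k \<in> N" if "k \<in> P \<or> k \<in> M \<or> k \<in> Z" for k
    using that insert.prems(2) by (auto simp: P_def M_def Z_def)
  have comb_N: "comb (k, l) \<in> N" if "k \<in> P" "l \<in> M" for k l
    using add[OF scale_pos[of k "- l j"] scale_pos[of l "k j"]] that PN
    by (auto simp: comb_def P_def M_def)
  \<comment> \<open>Strictness is pulled back: adding k j times l to the negated combination leaves
    a negative multiple of k, from which \<open>root\<close> recovers -k; symmetrically for
    l.\<close>
  have strict: "(\<lambda>i. - k i) \<in> N \<and> (\<lambda>i. - l i) \<in> N"
    if "k \<in> P" "l \<in> M" "(\<lambda>i. - comb (k, l) i) \<in> N" for k l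
  proof
    have pos: "0 < - l j" "0 < k j" using that by (auto simp: P_def M_def)
    have N: "k \<in> N" "l \<in> N" using that PN by auto
    show "(\<lambda>i. - k i) \<in> N"
      using add[OF that(3) scale_pos[OF N(2) pos(2)]] root[OF N(1) pos(1)]
      by (simp add: comb_def)
    show "(\<lambda>i. - l i) \<in> N"
      using add[OF that(3) scale_pos[OF N(1) pos(1)]] root[OF N(2) pos(2)]
      by (simp add: comb_def)
  qed
  have "finite K'" using insert.prems by (auto simp: K'_def P_def M_def Z_def)
  moreover have "K' \<subseteq> N" using comb_N PN by (auto simp: K'_def)
  moreover have "k i = 0" if "k \<in> K'" "i \<notin> I" for k i
  proof (cases "i = j")
    case False
    then have "l i = 0" if "l \<in> K" for l using insert.prems(3)[OF that] \<open>i \<notin> I\<close> by simp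
    then have "comb (a, b) i = 0" if "a \<in> K" "b \<in> K" for a b
      using \<open>\<And>l. l \<in> K \<Longrightarrow> l i = 0\<close>[OF that(1)] \<open>\<And>l. l \<in> K \<Longrightarrow> l i = 0\<close>[OF that(2)]
      by (simp add: comb_def)
    then show ?thesis using \<open>k \<in> K'\<close> \<open>\<And>l. l \<in> K \<Longrightarrow> l i = 0\<close>
      by (auto simp: K'_def P_def M_def Z_def)
  qed (use that in \<open>auto simp: K'_def comb_def Z_def\<close>)
  ultimately have "\<exists>x :: 'i \<Rightarrow> real. \<forall>k\<in>K'. 0 \<le> (\<Sum>i\<in>I. k i * x i) \<and>
    ((\<lambda>i. - k i) \<notin> N \<longrightarrow> 0 < (\<Sum>i\<in>I. k i * x i))"
    by (rule insert.IH)
  then obtain x :: "'i \<Rightarrow> real" where x: "\<And>k. k \<in> K' \<Longrightarrow> 0 \<le> (\<Sum>i\<in>I. k i * x i)"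
    "\<And>k. k \<in> K' \<Longrightarrow> (\<lambda>i. - k i) \<notin> N \<Longrightarrow> 0 < (\<Sum>i\<in>I. k i * x i)"
    by blast
  define S where "S k = (\<Sum>i\<in>I. k i * x i)" for k :: "'i \<Rightarrow> int"
  have S_comb: "S (comb (k, l)) = S l * k j - S k * l j" for k l
    by (simp add: S_def comb_def sum_distrib_left sum_subtractf algebra_simps)
  \<comment> \<open>Up to a positive factor, the combined form is the gap between the upper bound
    for coordinate j given by l and the lower bound given by k.\<close>
  have comb_iff: "S (comb (k, l)) = k j * (- l j) * (S l / - l j - (- S k / k j))"
    if "k \<in> P" "l \<in> M" for k l
    using that by (simp add: S_comb P_def M_def field_simps)
  have pos: "0 < real_of_int (k j) * (- l j)" if "k \<in> P" "l \<in> M" for k l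
    using that by (simp add: P_def M_def mult_pos_neg)
  have in_K': "comb (k, l) \<in> K'" if "k \<in> P" "l \<in> M" for k l
    using that by (auto simp: K'_def)
  have le: "- S k / k j \<le> S l / - l j" if "k \<in> P" "l \<in> M" for k l
    using x(1)[OF in_K'[OF that]] pos[OF that]
    unfolding S_def[symmetric] comb_iff[OF that] by (simp only: zero_le_mult_iff) linarith
  have less: "- S k / k j < S l / - l j"
    if "k \<in> P" "l \<in> M" "(\<lambda>i. - k i) \<notin> N \<or> (\<lambda>i. - l i) \<notin> N" for k l
  proof -
    have "0 < S (comb (k, l))"
      using x(2)[OF in_K'[OF that(1,2)]] strict[OF that(1,2)] that(3) unfolding S_def by blast
    then show ?thesis
      using zero_less_mult_pos[OF _ pos[OF that(1,2)]] unfolding comb_iff[OF that(1,2)] by fastforce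
  qed
  have fin: "finite P" "finite M" using insert.prems by (auto simp: P_def M_def)
  obtain t where t: "\<And>k. k \<in> P \<Longrightarrow> - S k / k j \<le> t" "\<And>l. l \<in> M \<Longrightarrow> t \<le> S l / - l j"
    "\<And>k. k \<in> P \<Longrightarrow> \<forall>l\<in>M. - S k / k j < S l / - l j \<Longrightarrow> - S k / k j < t"
    "\<And>l. l \<in> M \<Longrightarrow> \<forall>k\<in>P. - S k / k j < S l / - l j \<Longrightarrow> t < S l / - l j"
    by (rule between_bounds[where L = "\<lambda>k. - S k / k j" and U = "\<lambda>l. S l / - l j", OF fin le])
      (assumption, assumption, rule that)
  define x' where "x' = x(j := t)"
  have sum: "(\<Sum>i\<in>insert j I. k i * x' i) = k j * t + S k" for k :: "'i \<Rightarrow> int"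
  proof -
    have "(\<Sum>i\<in>I. k i * x' i) = S k"
      unfolding S_def using insert.hyps by (intro sum.cong) (auto simp: x'_def)
    then show ?thesis using insert.hyps by (simp add: x'_def)
  qed
  have bound_iff: "0 < c \<Longrightarrow> - s / c \<le> t \<longleftrightarrow> 0 \<le> c * t + s" "0 < c \<Longrightarrow> - s / c < t \<longleftrightarrow> 0 < c * t + s"
    "0 < - c \<Longrightarrow> t \<le> s / - c \<longleftrightarrow> 0 \<le> c * t + s" "0 < - c \<Longrightarrow> t < s / - c \<longleftrightarrow> 0 < c * t + s"
    for c s :: real by (auto simp: field_simps)
  have "0 \<le> (\<Sum>i\<in>insert j I. k i * x' i) \<and>
    ((\<lambda>i. - k i) \<notin> N \<longrightarrow> 0 < (\<Sum>i\<in>insert j I. k i * x' i))" if "k \<in> K" for k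
  proof -
    consider "k \<in> P" | "k \<in> M" | "k \<in> Z" using \<open>k \<in> K\<close>
      by (cases "k j" "0 :: int" rule: linorder_cases) (auto simp: P_def M_def Z_def)
    then show ?thesis
    proof cases
      case 1
      then have kj: "0 < real_of_int (k j)" by (simp add: P_def)
      have "(\<lambda>i. - k i) \<notin> N \<Longrightarrow> - S k / k j < t" using t(3)[OF 1] less[OF 1] by blast
      then show ?thesis using t(1)[OF 1]
        by (simp only: sum bound_iff(1,2)[OF kj]) blast
    next
      case 2
      then have kj: "0 < - real_of_int (k j)" by (simp add: M_def)
      have "(\<lambda>i. - k i) \<notin> N \<Longrightarrow> t < S k / - k j" using t(4)[OF 2] less[OF _ 2] by blast
      then show ?thesis using t(2)[OF 2]
        by (simp only: sum of_int_minus bound_iff(3,4)[OF kj]) blast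
    next
      case 3
      then show ?thesis using x[of k] by (auto simp: sum Z_def K'_def S_def)
    qed
  qed
  then show ?case by blast
qed

text \<open>The generated group is never formed: a formal difference of two lists of translations is
  non-negative when the first list moves the base point at least as far down as the second.\<close>

locale commuting_translations =
  fixes X :: "'x set" and le :: "'x \<Rightarrow> 'x \<Rightarrow> bool" and act :: "'a \<Rightarrow> 'x \<Rightarrow> 'x"
  assumes act_closed: "z \<in> X \<Longrightarrow> act a z \<in> X"
    and total: "le y z \<or> le z y"
    and le_trans [trans]: "le x y \<Longrightarrow> le y z \<Longrightarrow> le x z"
    and act_le_iff: "y \<in> X \<Longrightarrow> z \<in> X \<Longrightarrow> le (act a y) (act a z) \<longleftrightarrow> le y z"
    and act_comm: "z \<in> X \<Longrightarrow> le (act a (act b z)) (act b (act a z))"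
begin

section \<open>Lists of translations as elements of an ordered abelian group\<close>

definition acts :: "'a list \<Rightarrow> 'x \<Rightarrow> 'x" where "acts as = foldr act as"

lemma acts_simps [simp]:
  "acts [] z = z" "acts (a # as) z = act a (acts as z)" "acts (as @ bs) z = acts as (acts bs z)"
  by (simp_all add: acts_def)

lemma acts_closed: "z \<in> X \<Longrightarrow> acts as z \<in> X"
  by (induction as) (auto intro: act_closed)

lemma refl: "le z z"
  using total by blast

lemma acts_le_iff: "y \<in> X \<Longrightarrow> z \<in> X \<Longrightarrow> le (acts as y) (acts as z) \<longleftrightarrow> le y z"
  by (induction as) (auto simp: act_le_iff acts_closed)

lemma act_acts_comm: "z \<in> X \<Longrightarrow> le (act a (acts as z)) (acts as (act a z)) \<and>
    le (acts as (act a z)) (act a (acts as z))"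
proof (induction as)
  case (Cons b as)
  then have "le (act b (act a (acts as z))) (act b (acts as (act a z)))"
    "le (act b (acts as (act a z))) (act b (act a (acts as z)))"
    by (auto simp: act_le_iff acts_closed act_closed)
  then show ?case
    using le_trans[OF act_comm[OF acts_closed[OF Cons.prems], of a b]]
      le_trans[OF _ act_comm[OF acts_closed[OF Cons.prems], of b a]] by simp
qed (simp add: refl)

lemma acts_perm: "z \<in> X \<Longrightarrow> mset as = mset bs \<Longrightarrow> le (acts as z) (acts bs z)"
proof (induction as arbitrary: bs)
  case (Cons a as)
  then have "a \<in> set bs" by (metis list.set_intros(1) mset_eq_setD)
  then obtain cs ds where bs: "bs = cs @ a # ds" by (meson split_list)
  have "le (acts as z) (acts (cs @ ds) z)" using Cons.IH[of "cs @ ds"] Cons.prems bs by simp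
  then have "le (act a (acts as z)) (act a (acts cs (acts ds z)))"
    using Cons.prems by (simp add: act_le_iff acts_closed)
  also have "le (act a (acts cs (acts ds z))) (acts cs (act a (acts ds z)))"
    using act_acts_comm Cons.prems acts_closed by blast
  finally show ?case unfolding bs by simp
qed (simp add: refl)

definition count_diff :: "'a list \<times> 'a list \<Rightarrow> 'a \<Rightarrow> int" where
  "count_diff p i = int (count_list (fst p) i) - int (count_list (snd p) i)"

lemma count_diff_eq_iff:
  "count_diff (as, bs) = count_diff (cs, ds) \<longleftrightarrow> mset (as @ ds) = mset (cs @ bs)"
proof -
  have "count_diff (as, bs) i = count_diff (cs, ds) i \<longleftrightarrow>
      count (mset (as @ ds)) i = count (mset (cs @ bs)) i" for i
    by (simp add: count_diff_def count_mset) linarith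
  then show ?thesis unfolding fun_eq_iff multiset_eq_iff by simp
qed

text \<open>Plays the part of passing to the group of differences: append \<open>ds\<close> on both
  sides, rearrange, and cancel \<open>bs\<close>, which is possible because translations reflect the
  order.\<close>

lemma nonneg_well_defined:
  assumes "z \<in> X" "mset (as @ ds) = mset (cs @ bs)" "le (acts as z) (acts bs z)"
  shows "le (acts cs z) (acts ds z)"
proof -
  have "mset (bs @ cs) = mset (as @ ds)" using assms(2) by simp
  then have "le (acts (bs @ cs) z) (acts (as @ ds) z)" by (rule acts_perm[OF assms(1)])
  also have "le (acts (as @ ds) z) (acts (ds @ as) z)" by (rule acts_perm[OF assms(1)]) simp
  also have "le (acts (ds @ as) z) (acts (ds @ bs) z)"
    using assms(1,3) by (simp add: acts_le_iff acts_closed)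
  also have "le (acts (ds @ bs) z) (acts (bs @ ds) z)" by (rule acts_perm[OF assms(1)]) simp
  finally show ?thesis using assms(1) by (simp add: acts_le_iff acts_closed)
qed

lemma sum_count_diff:
  fixes x :: "'a \<Rightarrow> real"
  assumes "finite I" "set as \<subseteq> I" "set bs \<subseteq> I"
  shows "(\<Sum>i\<in>I. count_diff (as, bs) i * x i) = sum_list (map x as) - sum_list (map x bs)"
proof -
  have "(\<Sum>i\<in>I. count_list cs i * x i) = sum_list (map x cs)" if "set cs \<subseteq> I" for cs
    using that
  proof (induction cs)
    case (Cons c cs)
    have "(\<Sum>i\<in>I. count_list (c # cs) i * x i) =
        (\<Sum>i\<in>I. (if i = c then x i else 0) + count_list cs i * x i)"
      by (intro sum.cong) (auto simp: algebra_simps)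
    then show ?case using Cons assms(1) by (simp add: sum.distrib)
  qed simp
  from this[OF assms(2)] this[OF assms(3)] show ?thesis
    by (simp add: count_diff_def left_diff_distrib sum_subtractf)
qed

text \<open>Larger sums correspond to lower points, as the translations move downwards. Restricting
  to a finite \<open>C\<close> lets infinitesimal translations be given ordinary real sizes.\<close>

theorem real_realization:
  assumes "z \<in> X" "finite I" "finite C" "\<And>as bs. (as, bs) \<in> C \<Longrightarrow> set as \<subseteq> I \<and> set bs \<subseteq> I"
  obtains x :: "'a \<Rightarrow> real" where
    "\<And>as bs. (as, bs) \<in> C \<Longrightarrow>
      le (acts as z) (acts bs z) \<longleftrightarrow> sum_list (map x bs) \<le> sum_list (map x as)"
proof -
  define N where "N = {count_diff (as, bs) | as bs. le (acts as z) (acts bs z)}"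
  have N_iff: "count_diff (as, bs) \<in> N \<longleftrightarrow> le (acts as z) (acts bs z)" for as bs
  proof
    assume "count_diff (as, bs) \<in> N"
    then obtain cs ds where "count_diff (cs, ds) = count_diff (as, bs)" "le (acts cs z) (acts ds z)"
      unfolding N_def by auto
    then show "le (acts as z) (acts bs z)"
      using nonneg_well_defined[OF assms(1)] unfolding count_diff_eq_iff by blast
  qed (auto simp: N_def)
  have add: "(\<lambda>i. k i + l i) \<in> N" if kl: "k \<in> N" "l \<in> N" for k l
  proof -
    obtain as bs cs ds where k: "k = count_diff (as, bs)" "le (acts as z) (acts bs z)"
      and l: "l = count_diff (cs, ds)" "le (acts cs z) (acts ds z)"
      using kl unfolding N_def by auto
    have "le (acts (as @ cs) z) (acts (as @ ds) z)"
      using l assms(1) by (simp add: acts_le_iff acts_closed)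
    also have "le (acts (as @ ds) z) (acts (ds @ as) z)" by (rule acts_perm[OF assms(1)]) simp
    also have "le (acts (ds @ as) z) (acts (ds @ bs) z)"
      using k assms(1) by (simp add: acts_le_iff acts_closed)
    finally have "count_diff (as @ cs, ds @ bs) \<in> N" by (simp only: N_iff)
    moreover have "count_diff (as @ cs, ds @ bs) = (\<lambda>i. k i + l i)"
      by (auto simp: k l count_diff_def)
    ultimately show ?thesis by simp
  qed
  have neg: "(\<lambda>i. - count_diff (as, bs) i) = count_diff (bs, as)" for as bs
    by (auto simp: count_diff_def)
  \<comment> \<open>Every comparison enters in both orientations. By totality at least one of them
    lies in \<open>N\<close>; if only one does, its sum comes out strictly positive, and this
    settles the comparison that fails.\<close>
  have "finite (count_diff ` (C \<union> prod.swap ` C) \<inter> N)" using assms by auto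
  moreover have "k i = 0" if "k \<in> count_diff ` (C \<union> prod.swap ` C) \<inter> N" "i \<notin> I" for k i
    using that assms(4) by (auto simp: count_diff_def) (metis count_notin subsetD)+
  ultimately have "\<exists>x :: 'a \<Rightarrow> real. \<forall>k\<in>count_diff ` (C \<union> prod.swap ` C) \<inter> N.
    0 \<le> (\<Sum>i\<in>I. k i * x i) \<and> ((\<lambda>i. - k i) \<notin> N \<longrightarrow> 0 < (\<Sum>i\<in>I. k i * x i))"
    using fourier_motzkin[OF assms(2) _ _ _ add, of "count_diff ` (C \<union> prod.swap ` C) \<inter> N"] by blast
  then obtain x :: "'a \<Rightarrow> real" where
    x: "\<And>k. k \<in> count_diff ` (C \<union> prod.swap ` C) \<inter> N \<Longrightarrow> 0 \<le> (\<Sum>i\<in>I. k i * x i) \<and>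
    ((\<lambda>i. - k i) \<notin> N \<longrightarrow> 0 < (\<Sum>i\<in>I. k i * x i))"
    by blast
  show thesis
  proof
    fix as bs assume C: "(as, bs) \<in> C"
    then have I: "set as \<subseteq> I" "set bs \<subseteq> I" using assms(4) by auto
    have img: "count_diff (as, bs) \<in> count_diff ` (C \<union> prod.swap ` C)"
      "count_diff (bs, as) \<in> count_diff ` (C \<union> prod.swap ` C)"
      using C by (force intro!: imageI)+
    show "le (acts as z) (acts bs z) \<longleftrightarrow> sum_list (map x bs) \<le> sum_list (map x as)"
    proof (cases "le (acts as z) (acts bs z)")
      case True
      then have "0 \<le> (\<Sum>i\<in>I. count_diff (as, bs) i * x i)" using x img by (simp add: N_iff)
      then show ?thesis using True unfolding sum_count_diff[OF assms(2) I] by simp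
    next
      case False
      then have "le (acts bs z) (acts as z)" using total by blast
      then show ?thesis
        using False x[of "count_diff (bs, as)"] img(2) unfolding neg
        by (simp add: N_iff sum_count_diff[OF assms(2) I(2,1)])
    qed
  qed
qed

end

section \<open>Linear Lukasiewicz theories\<close>

locale lukasiewicz_chain = lukasiewicz_theory +
  assumes linear: "x \<sqsubseteq> y \<or> y \<sqsubseteq> x"
begin

text \<open>A pair \<open>(n, c)\<close> with \<open>c \<noteq> 1\<close> stands for \<open>n + c\<close> in Chang's ordered group of the chain;
  \<open>sub a\<close> subtracts \<open>a\<close>.\<close>

fun sub :: "'a \<Rightarrow> int \<times> 'a \<Rightarrow> int \<times> 'a" where
  "sub a (n, c) = (if a \<sqsubseteq> c then (n, \<sim> (c \<leadsto> a)) else (n - 1, a \<leadsto> c))"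

fun lex_le :: "int \<times> 'a \<Rightarrow> int \<times> 'a \<Rightarrow> bool" where
  "lex_le (n, c) (m, d) \<longleftrightarrow> n < m \<or> n = m \<and> c \<sqsubseteq> d"

definition proper :: "(int \<times> 'a) set" where "proper = {z. snd z \<notin> T}"

section \<open>Subtraction in Chang's group: monotone, cancellative, commuting\<close>

lemma diff_le: "\<sim> (c \<leadsto> a) \<sqsubseteq> c"
  by (rule le_mp[OF neg_imp neg_imp_swap])

lemma diff_le_neg: "\<sim> (c \<leadsto> a) \<sqsubseteq> \<sim> a"
  by (rule neg_anti[OF ax_w])

lemma sub_proper: "z \<in> proper \<Longrightarrow> sub a z \<in> proper"
  by (cases z) (auto simp: proper_def le_def dest: mem_mp[OF _ diff_le])

lemma lex_total: "lex_le y z \<or> lex_le z y"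
  using linear by (cases y; cases z) auto

lemma lex_trans: "lex_le x y \<Longrightarrow> lex_le y z \<Longrightarrow> lex_le x z"
  using le_trans by (cases x; cases y; cases z) auto

lemma sub_mono:
  assumes "lex_le y z" shows "lex_le (sub a y) (sub a z)"
proof -
  obtain n c m d where yz: "y = (n, c)" "z = (m, d)" by (cases y; cases z) auto
  have "\<sim> (c \<leadsto> a) \<sqsubseteq> a \<leadsto> d" by (rule le_trans[OF diff_le_neg neg_imp])
  moreover have "c \<sqsubseteq> d \<Longrightarrow> \<sim> (c \<leadsto> a) \<sqsubseteq> \<sim> (d \<leadsto> a)" by (intro neg_anti imp_anti)
  moreover have "c \<sqsubseteq> d \<Longrightarrow> a \<sqsubseteq> c \<Longrightarrow> a \<sqsubseteq> d" using le_trans by blast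
  ultimately show ?thesis using assms imp_mono[of c d a] unfolding yz by auto
qed

text \<open>Properness rules out that (m, 1) and (m + 1, 0) name the same group element: if m < n,
  the compared results force d into \<open>T\<close>, which is just this ambiguity.\<close>

lemma sub_mono_rev:
  assumes "lex_le (sub a y) (sub a z)" "z \<in> proper" shows "lex_le y z"
proof (rule ccontr)
  obtain n c m d where yz: "y = (n, c)" "z = (m, d)" by (cases y; cases z) auto
  assume "\<not> lex_le y z"
  then have "m < n \<or> m = n \<and> \<not> c \<sqsubseteq> d" unfolding yz by auto
  moreover have False if "m < n"
  proof -
    have *: "\<not> a \<sqsubseteq> c" "a \<sqsubseteq> d" "a \<leadsto> c \<sqsubseteq> \<sim> (d \<leadsto> a)"
      using assms that unfolding yz by (auto split: if_splits)
    have "\<sim> a \<sqsubseteq> \<sim> (d \<leadsto> a)" by (rule le_trans[OF neg_imp *(3)])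
    then have "d \<leadsto> a \<sqsubseteq> a" by (rule neg_antiD)
    then have "a \<leadsto> d \<sqsubseteq> d" by (rule le_mp[OF _ ax_waj])
    then have "d \<in> T" using *(2) mem_mp unfolding le_def by blast
    then show False using assms(2) by (auto simp: yz proper_def)
  qed
  moreover have False if "m = n" "\<not> c \<sqsubseteq> d"
  proof (cases "a \<sqsubseteq> d")
    case True
    have "d \<sqsubseteq> c" using that linear by blast
    then have "a \<sqsubseteq> c" using True le_trans by blast
    then have "\<sim> (c \<leadsto> a) \<sqsubseteq> \<sim> (d \<leadsto> a)" using assms(1) that True unfolding yz by auto
    then have *: "d \<leadsto> a \<sqsubseteq> c \<leadsto> a" by (rule neg_antiD)
    have "c \<sqsubseteq> (c \<leadsto> a) \<leadsto> a" by (rule le_imp_imp)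
    also have "\<dots> \<sqsubseteq> (d \<leadsto> a) \<leadsto> a" by (rule imp_anti[OF *])
    also have "\<dots> \<sqsubseteq> (a \<leadsto> d) \<leadsto> d" by (rule ax_waj)
    also have "\<dots> \<sqsubseteq> d" using True by (rule top_imp')
    finally show False using that by simp
  next
    case False
    then have "\<not> a \<sqsubseteq> c \<and> a \<leadsto> c \<sqsubseteq> a \<leadsto> d"
      using assms(1) that unfolding yz by (auto split: if_splits)
    moreover from this have "c \<sqsubseteq> a \<odot> (a \<leadsto> c)" using linear divisibility by blast
    ultimately have "c \<sqsubseteq> d" using le_trans[OF le_trans[OF _ odot_mono[OF le_refl]] odot_imp] by blast
    then show False using that by simp
  qed
  ultimately show False by blast
qed

text \<open>Negated, both sides are max 0 (a + b - c). The proof writes b as c \<odot> (c \<leadsto>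
  b) by divisibility and regroups.\<close>

lemma diff_swap:
  assumes "a \<sqsubseteq> c" "b \<sqsubseteq> c"
  shows "a \<leadsto> \<sim> (c \<leadsto> b) \<sqsubseteq> b \<leadsto> \<sim> (c \<leadsto> a)"
proof -
  have "b \<odot> (c \<leadsto> a) \<sqsubseteq> (c \<odot> (c \<leadsto> b)) \<odot> (c \<leadsto> a)"
    by (rule odot_mono[OF divisibility[OF assms(2)] le_refl])
  also have "\<dots> \<sqsubseteq> c \<odot> ((c \<leadsto> b) \<odot> (c \<leadsto> a))" by (rule odot_assoc)
  also have "\<dots> \<sqsubseteq> c \<odot> ((c \<leadsto> a) \<odot> (c \<leadsto> b))" by (rule odot_mono[OF le_refl odot_comm])
  also have "\<dots> \<sqsubseteq> (c \<odot> (c \<leadsto> a)) \<odot> (c \<leadsto> b)" by (rule odot_assoc')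
  also have "\<dots> \<sqsubseteq> a \<odot> (c \<leadsto> b)" by (rule odot_mono[OF odot_imp le_refl])
  finally show ?thesis by (rule neg_antiD)
qed

text \<open>This is \<open>diff_swap\<close> for the negated elements, whose order is
  reversed.\<close>

lemma diff_swap_dual:
  assumes "c \<sqsubseteq> a" "c \<sqsubseteq> b"
  shows "(a \<leadsto> c) \<leadsto> b \<sqsubseteq> (b \<leadsto> c) \<leadsto> a"
proof -
  have "(a \<leadsto> c) \<leadsto> b \<sqsubseteq> \<sim> b \<leadsto> \<sim> (a \<leadsto> c)" by (rule contrapos_le)
  also have "\<dots> \<sqsubseteq> \<sim> b \<leadsto> \<sim> (\<sim> c \<leadsto> \<sim> a)" by (intro imp_mono neg_anti ax_co)
  also have "\<dots> \<sqsubseteq> \<sim> a \<leadsto> \<sim> (\<sim> c \<leadsto> \<sim> b)" using assms by (intro diff_swap neg_anti)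
  also have "\<dots> \<sqsubseteq> \<sim> a \<leadsto> \<sim> (b \<leadsto> c)" by (intro imp_mono neg_anti contrapos_le)
  also have "\<dots> \<sqsubseteq> (b \<leadsto> c) \<leadsto> a" by (rule ax_co)
  finally show ?thesis .
qed

lemma diff_diff: "\<sim> (\<sim> (c \<leadsto> b) \<leadsto> a) \<sqsubseteq> \<sim> (\<sim> (c \<leadsto> a) \<leadsto> b)"
proof -
  have "\<sim> (c \<leadsto> a) \<leadsto> b \<sqsubseteq> \<sim> b \<leadsto> (c \<leadsto> a)" by (rule neg_imp_swap)
  also have "\<dots> \<sqsubseteq> c \<leadsto> (\<sim> b \<leadsto> a)" by (rule exchange)
  also have "\<dots> \<sqsubseteq> c \<leadsto> (\<sim> a \<leadsto> b)" by (rule imp_mono[OF neg_imp_swap])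
  also have "\<dots> \<sqsubseteq> \<sim> a \<leadsto> (c \<leadsto> b)" by (rule exchange)
  also have "\<dots> \<sqsubseteq> \<sim> (c \<leadsto> b) \<leadsto> a" by (rule neg_imp_swap)
  finally show ?thesis by (rule neg_anti)
qed

text \<open>Together with \<open>imp_diff\<close> this is the mixed case of commutation, where
  exactly one of the two subtractions borrows and the fractional part is 1 - b + c - a in either
  order.\<close>

lemma diff_imp: "\<sim> ((b \<leadsto> c) \<leadsto> a) \<sqsubseteq> b \<leadsto> \<sim> (c \<leadsto> a)"
proof -
  have "c \<leadsto> a \<sqsubseteq> (b \<odot> (b \<leadsto> c)) \<leadsto> a" by (rule imp_anti[OF odot_imp])
  also have "\<dots> \<sqsubseteq> b \<leadsto> ((b \<leadsto> c) \<leadsto> a)" by (rule curry_le)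
  finally have "b \<sqsubseteq> (c \<leadsto> a) \<leadsto> ((b \<leadsto> c) \<leadsto> a)" by (rule le_mp[OF _ exchange])
  then have "b \<sqsubseteq> \<sim> ((b \<leadsto> c) \<leadsto> a) \<leadsto> \<sim> (c \<leadsto> a)" by (rule le_trans[OF _ contrapos_le])
  then show ?thesis by (rule le_mp[OF _ exchange])
qed

lemma imp_diff:
  assumes "b \<sqsubseteq> c" "c \<sqsubseteq> a"
  shows "a \<leadsto> \<sim> (c \<leadsto> b) \<sqsubseteq> \<sim> ((a \<leadsto> c) \<leadsto> b)"
proof -
  let ?y = "(a \<leadsto> c) \<leadsto> b"
  have "?y \<sqsubseteq> (a \<leadsto> c) \<leadsto> c" by (rule imp_mono[OF assms(1)])
  also have "\<dots> \<sqsubseteq> (c \<leadsto> a) \<leadsto> a" by (rule ax_waj)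
  also have "\<dots> \<sqsubseteq> a" by (rule top_imp'[OF assms(2)])
  finally have "?y \<sqsubseteq> a \<odot> (a \<leadsto> ?y)" by (rule divisibility)
  also have "a \<leadsto> ?y \<sqsubseteq> (a \<odot> (a \<leadsto> c)) \<leadsto> b" by (rule uncurry_le)
  then have "a \<leadsto> ?y \<sqsubseteq> c \<leadsto> b" by (rule le_trans[OF _ imp_anti[OF divisibility[OF assms(2)]]])
  then have "a \<odot> (a \<leadsto> ?y) \<sqsubseteq> a \<odot> (c \<leadsto> b)" by (rule odot_mono[OF le_refl])
  finally show ?thesis using neg_anti[of ?y] le_trans[OF le_dneg] by blast
qed

text \<open>Both conditions mean a + b \<le> c, so the second subtraction borrows in one order
  exactly if it does in the other.\<close>

lemma le_diff_swap:
  assumes "b \<sqsubseteq> c" "a \<sqsubseteq> \<sim> (c \<leadsto> b)" shows "b \<sqsubseteq> \<sim> (c \<leadsto> a)"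
proof -
  have "c \<leadsto> b \<sqsubseteq> \<sim> a" by (rule le_mp[OF assms(2) imp_neg_swap])
  then have "c \<odot> (c \<leadsto> b) \<sqsubseteq> c \<odot> \<sim> a" by (rule odot_mono[OF le_refl])
  also have "\<dots> \<sqsubseteq> \<sim> (c \<leadsto> a)" by (intro neg_anti imp_mono le_dneg)
  finally show ?thesis by (rule le_trans[OF divisibility[OF assms(1)]])
qed

text \<open>Both orders borrow equally often, so the integer parts agree; in each case one of the
  preceding inequalities or exchange compares the fractional parts. One direction suffices, as a and
  b may be swapped.\<close>

lemma sub_comm: "lex_le (sub a (sub b z)) (sub b (sub a z))"
proof -
  obtain n c where z: "z = (n, c)" by (cases z)
  have nle: "\<not> x \<sqsubseteq> \<sim> (c \<leadsto> y)" if "\<not> x \<sqsubseteq> c" for x y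
    using that le_trans[OF _ diff_le] by blast
  have le: "x \<sqsubseteq> y \<leadsto> c" if "x \<sqsubseteq> c" for x y
    by (rule le_trans[OF that ax_w])
  show ?thesis
  proof (cases "a \<sqsubseteq> c"; cases "b \<sqsubseteq> c")
    assume *: "a \<sqsubseteq> c" "b \<sqsubseteq> c"
    then have "a \<sqsubseteq> \<sim> (c \<leadsto> b) \<longleftrightarrow> b \<sqsubseteq> \<sim> (c \<leadsto> a)" using le_diff_swap by blast
    then show ?thesis using * diff_diff diff_swap[OF *] unfolding z by simp
  next
    assume "a \<sqsubseteq> c" "\<not> b \<sqsubseteq> c"
    then show ?thesis using le nle diff_imp unfolding z by simp
  next
    assume *: "\<not> a \<sqsubseteq> c" "b \<sqsubseteq> c"
    then have "c \<sqsubseteq> a" using linear by blast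
    then show ?thesis using * le nle imp_diff unfolding z by simp
  next
    assume *: "\<not> a \<sqsubseteq> c" "\<not> b \<sqsubseteq> c"
    then have "c \<sqsubseteq> a" "c \<sqsubseteq> b" using linear by blast+
    moreover have "a \<sqsubseteq> b \<leadsto> c \<longleftrightarrow> b \<sqsubseteq> a \<leadsto> c" using le_mp[OF _ exchange] by blast
    ultimately show ?thesis
      using * neg_anti[OF diff_swap_dual] exchange unfolding z by simp
  qed
qed

sublocale shift: commuting_translations proper lex_le sub
  by unfold_locales
    (fact sub_proper lex_total lex_trans | rule sub_comm | rule iffI | erule sub_mono_rev sub_mono | assumption)+

section \<open>Recovering the chain from its translations\<close>

text \<open>The base point is the zero of the group, so a sends it to -a and the order is reversed.
  The cases arise because subtracting borrows unless the subtracted element is itself zero.\<close>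

lemma act_bot_le_iff:
  assumes "t \<in> T" "\<sim> t \<notin> T"
  shows "lex_le (shift.acts [a] (0, \<sim> t)) (shift.acts [b] (0, \<sim> t)) \<longleftrightarrow> b \<sqsubseteq> a"
proof (cases "a \<sqsubseteq> \<sim> t")
  case a: True
  show ?thesis
  proof (cases "b \<sqsubseteq> \<sim> t")
    case True
    have "b \<sqsubseteq> a" by (rule le_trans[OF True neg_top_le[OF assms(1)]])
    moreover have "\<sim> (\<sim> t \<leadsto> a) \<sqsubseteq> \<sim> (\<sim> t \<leadsto> b)" using neg_anti imp_mono[OF \<open>b \<sqsubseteq> a\<close>] by blast
    ultimately show ?thesis using a True by simp
  next
    case False
    then have "\<not> b \<sqsubseteq> a" using a le_trans by blast
    then show ?thesis using a False by simp
  qed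
next
  case a: False
  show ?thesis
  proof (cases "b \<sqsubseteq> \<sim> t")
    case True
    have "b \<sqsubseteq> a" by (rule le_trans[OF True neg_top_le[OF assms(1)]])
    then show ?thesis using a True by simp
  next
    case False
    have "b \<sqsubseteq> a" if "a \<leadsto> \<sim> t \<sqsubseteq> b \<leadsto> \<sim> t"
      by (rule neg_antiD, rule le_trans[OF le_trans[OF neg_imp that] imp_bot_le[OF assms(1)]])
    then show ?thesis using a False imp_anti[of b a "\<sim> t"] by auto
  qed
qed

text \<open>For a above b there is no truncation, and the implication is determined by the group
  equation (a \<leadsto> b) + a = b + 1, with t as the unit. Whether b is zero decides if the second
  subtraction borrows.\<close>

lemma acts_imp:
  assumes "t \<in> T" "\<sim> t \<notin> T" "\<not> a \<sqsubseteq> b"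
  shows "lex_le (shift.acts [a \<leadsto> b, a] (0, \<sim> t)) (shift.acts [b, t] (0, \<sim> t))"
    and "lex_le (shift.acts [b, t] (0, \<sim> t)) (shift.acts [a \<leadsto> b, a] (0, \<sim> t))"
proof -
  let ?o = "\<sim> t"
  have bot: "?o \<sqsubseteq> x" for x by (rule neg_top_le[OF assms(1)])
  have "b \<sqsubseteq> a" using assms(3) linear by blast
  then have div: "b \<sqsubseteq> (a \<leadsto> b) \<odot> a" by (rule le_trans[OF divisibility odot_comm])
  have na: "\<not> a \<sqsubseteq> ?o" using assms(3) le_trans[OF _ bot] by blast
  have nt: "\<not> t \<sqsubseteq> ?o" using assms(1,2) mem_mp by blast
  have tb: "t \<leadsto> ?o \<sqsubseteq> ?o" by (rule top_imp[OF assms(1)])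
  have b1: "b \<sqsubseteq> t \<leadsto> ?o \<longleftrightarrow> b \<sqsubseteq> ?o" using le_trans[OF _ tb] le_trans[OF _ ax_w] by blast
  have b2: "a \<leadsto> b \<sqsubseteq> a \<leadsto> ?o \<longleftrightarrow> b \<sqsubseteq> ?o"
  proof
    assume "a \<leadsto> b \<sqsubseteq> a \<leadsto> ?o"
    then have "(a \<leadsto> b) \<odot> a \<sqsubseteq> ?o" by (simp only: odot_residual)
    then show "b \<sqsubseteq> ?o" by (rule le_trans[OF div])
  qed (rule imp_mono)
  have "lex_le (shift.acts [a \<leadsto> b, a] (0, ?o)) (shift.acts [b, t] (0, ?o)) \<and>
    lex_le (shift.acts [b, t] (0, ?o)) (shift.acts [a \<leadsto> b, a] (0, ?o))"
  proof (cases "b \<sqsubseteq> ?o")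
    case True
    have "(a \<leadsto> ?o) \<leadsto> (a \<leadsto> b) \<in> T" using imp_mono[OF bot] unfolding le_def .
    moreover have "(t \<leadsto> ?o) \<leadsto> b \<in> T" using le_trans[OF tb bot] unfolding le_def .
    ultimately show ?thesis using True na nt b1 b2 neg_top_le by simp
  next
    case False
    have "(a \<leadsto> b) \<leadsto> (a \<leadsto> ?o) \<sqsubseteq> ((a \<leadsto> b) \<odot> a) \<leadsto> ?o" by (rule uncurry_le)
    also have "\<dots> \<sqsubseteq> b \<leadsto> ?o" by (rule imp_anti[OF div])
    also have "\<dots> \<sqsubseteq> b \<leadsto> (t \<leadsto> ?o)" by (rule imp_mono[OF ax_w])
    finally have 1: "(a \<leadsto> b) \<leadsto> (a \<leadsto> ?o) \<sqsubseteq> b \<leadsto> (t \<leadsto> ?o)" .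
    have "b \<leadsto> (t \<leadsto> ?o) \<sqsubseteq> b \<leadsto> ?o" by (rule imp_mono[OF tb])
    also have "\<dots> \<sqsubseteq> (a \<odot> (a \<leadsto> b)) \<leadsto> ?o" by (rule imp_anti[OF odot_imp])
    also have "\<dots> \<sqsubseteq> ((a \<leadsto> b) \<odot> a) \<leadsto> ?o" by (rule imp_anti[OF odot_comm])
    also have "\<dots> \<sqsubseteq> (a \<leadsto> b) \<leadsto> (a \<leadsto> ?o)" by (rule curry_le)
    finally show ?thesis using 1 False na nt b1 b2 by simp
  qed
  then show "lex_le (shift.acts [a \<leadsto> b, a] (0, ?o)) (shift.acts [b, t] (0, ?o))"
    "lex_le (shift.acts [b, t] (0, ?o)) (shift.acts [a \<leadsto> b, a] (0, ?o))" by blast+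
qed

theorem finite_partial_embedding:
  assumes "finite B" "t \<in> T" "\<sim> t \<notin> T"
  obtains x :: "'a \<Rightarrow> real" where
    "\<And>a. a \<in> B \<Longrightarrow> 0 \<le> x a \<and> x a \<le> 1"
    "\<And>a b. a \<in> B \<Longrightarrow> b \<in> B \<Longrightarrow> x a \<le> x b \<longleftrightarrow> a \<sqsubseteq> b"
    "\<And>a. a \<in> B \<Longrightarrow> x a = 1 \<longleftrightarrow> a \<in> T"
    "\<And>a b. a \<in> B \<Longrightarrow> b \<in> B \<Longrightarrow> a \<leadsto> b \<in> B \<Longrightarrow> x (a \<leadsto> b) = min 1 (1 - x a + x b)"
    "\<And>a. a \<in> B \<Longrightarrow> \<sim> a \<in> B \<Longrightarrow> x (\<sim> a) = 1 - x a"
proof -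
  let ?o = "\<sim> t" and ?z = "(0 :: int, \<sim> t)"
  \<comment> \<open>The unit t and the zero \<sim> t are adjoined for normalisation, and a
    \<leadsto> \<sim> t because negation will be computed as implication into zero.\<close>
  define B' where "B' = B \<union> {t, ?o} \<union> (\<lambda>a. a \<leadsto> ?o) ` B"
  \<comment> \<open>Length two is enough: order compares singletons, implication compares
    [a \<leadsto> b, a] with [b, t], and the empty list fixes the value of zero.\<close>
  define C where "C = {as. set as \<subseteq> B' \<and> length as \<le> 2}"
  have fin: "finite B'" using assms(1) by (simp add: B'_def)
  then have finC: "finite (C \<times> C)"
    unfolding C_def by (intro finite_cartesian_product finite_lists_length_le)
  have proper: "?z \<in> proper" using assms(3) by (simp add: proper_def)
  have "set as \<subseteq> B' \<and> set bs \<subseteq> B'" if "(as, bs) \<in> C \<times> C" for as bs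
    using that by (simp add: C_def)
  from shift.real_realization[OF proper fin finC this]
  obtain y :: "'a \<Rightarrow> real" where y: "\<And>as bs. (as, bs) \<in> C \<times> C \<Longrightarrow>
      lex_le (shift.acts as ?z) (shift.acts bs ?z) \<longleftrightarrow> sum_list (map y bs) \<le> sum_list (map y as)"
    by blast
  have y_le: "y b \<le> y a \<longleftrightarrow> b \<sqsubseteq> a" if "a \<in> B'" "b \<in> B'" for a b
    using y[of "[a]" "[b]"] that act_bot_le_iff[OF assms(2,3)] by (simp add: C_def)
  have y_imp: "y (a \<leadsto> b) + y a = y b + y t"
    if "a \<in> B'" "b \<in> B'" "a \<leadsto> b \<in> B'" "\<not> a \<sqsubseteq> b" for a b
  proof -
    have "[a \<leadsto> b, a] \<in> C" "[b, t] \<in> C" using that by (auto simp: C_def B'_def)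
    then have "sum_list (map y [a \<leadsto> b, a]) = sum_list (map y [b, t])"
      using y acts_imp[OF assms(2,3) that(4)] by (metis SigmaI order_antisym)
    then show ?thesis by simp
  qed
  have tB: "t \<in> B'" "?o \<in> B'" by (auto simp: B'_def)
  have "?o \<sqsubseteq> ?o" by (rule le_refl)
  have o1: "sub ?o ?z = (0, \<sim> (?o \<leadsto> ?o))" using le_refl by simp
  have "\<sim> (?o \<leadsto> ?o) \<sqsubseteq> ?o" "?o \<sqsubseteq> \<sim> (?o \<leadsto> ?o)"
    using neg_top_le le_refl assms(2) unfolding le_def by blast+
  then have "lex_le (shift.acts [?o] ?z) (shift.acts [] ?z)" "lex_le (shift.acts [] ?z) (shift.acts [?o] ?z)"
    unfolding shift.acts_simps o1 by auto
  then have y0: "y ?o = 0" using y[of "[?o]" "[]"] y[of "[]" "[?o]"] tB by (simp add: C_def)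
  have "\<not> t \<sqsubseteq> ?o" using assms(2,3) mem_mp by blast
  then have pos: "0 < y t" using y_le[OF tB(2,1)] y0 by simp
  have y_bounds: "0 \<le> y a \<and> y a \<le> y t" if "a \<in> B'" for a
    using y_le[OF that tB(2)] y_le[OF tB(1) that] le_top[OF assms(2)] neg_top_le[OF assms(2)] y0 by simp
  have y_top: "y a = y t \<longleftrightarrow> a \<in> T" if "a \<in> B'" for a
    using y_le[OF that tB(1)] y_bounds[OF that] le_top mem_mp[OF assms(2)] by (metis antisym order_refl)
  have y_imp': "y (a \<leadsto> b) = min (y t) (y t - y a + y b)"
    if "a \<in> B'" "b \<in> B'" "a \<leadsto> b \<in> B'" for a b
  proof (cases "a \<sqsubseteq> b")
    case True
    then have "a \<leadsto> b \<in> T" unfolding le_def .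
    then show ?thesis using y_top[OF that(3)] y_le[OF that(2,1)] True by simp
  next
    case False
    then show ?thesis using y_imp[OF that False] y_le[OF that(2,1)] by simp
  qed
  have y_neg: "y (\<sim> a) = y t - y a" if "a \<in> B" "\<sim> a \<in> B" for a
  proof -
    have B': "a \<in> B'" "a \<leadsto> ?o \<in> B'" "\<sim> a \<in> B'" using that by (auto simp: B'_def)
    have "y (\<sim> a) = y (a \<leadsto> ?o)"
      using y_le[OF B'(2,3)] y_le[OF B'(3,2)] neg_imp imp_bot_le[OF assms(2)] by (simp add: order_antisym)
    also have "\<dots> = y t - y a" using y_imp'[OF B'(1) tB(2) B'(2)] y_bounds[OF B'(1)] y0 by simp
    finally show ?thesis .
  qed
  have sub: "a \<in> B'" if "a \<in> B" for a using that by (simp add: B'_def)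
  show thesis
  \<comment> \<open>The realization fixes no scale; dividing by the value of the unit sends the top
    to 1.\<close>
  proof (rule that[of "\<lambda>a. y a / y t"])
    fix a assume a: "a \<in> B"
    show "0 \<le> y a / y t \<and> y a / y t \<le> 1" using y_bounds[OF sub[OF a]] pos by simp
    show "y a / y t = 1 \<longleftrightarrow> a \<in> T"
      using y_top[OF sub[OF a]] pos unfolding divide_eq_1_iff by auto
    show "y (\<sim> a) / y t = 1 - y a / y t" if "\<sim> a \<in> B"
      using y_neg[OF a that] pos by (simp add: field_simps)
    fix b assume b: "b \<in> B"
    show "y a / y t \<le> y b / y t \<longleftrightarrow> a \<sqsubseteq> b"
      using y_le[OF sub[OF b] sub[OF a]] pos by (simp add: divide_le_cancel)
    show "y (a \<leadsto> b) / y t = min 1 (1 - y a / y t + y b / y t)" if "a \<leadsto> b \<in> B"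
      using y_imp'[OF sub[OF a] sub[OF b] sub[OF that]] pos by (simp add: min_def field_simps)
  qed
qed

end

section \<open>Belnap--Dunn normal forms and additive measures\<close>

lemma bd_refl: "\<phi> \<turnstile>\<^sub>B\<^sub>D \<phi>"
  by (rule bd_derives.cut[OF bd_derives.dnegI bd_derives.dnegE])

lemma bd_conj_mono: "\<phi> \<turnstile>\<^sub>B\<^sub>D \<phi>' \<Longrightarrow> \<psi> \<turnstile>\<^sub>B\<^sub>D \<psi>' \<Longrightarrow> BAnd \<phi> \<psi> \<turnstile>\<^sub>B\<^sub>D BAnd \<phi>' \<psi>'"
  by (rule bd_derives.conjI[OF bd_derives.cut[OF bd_derives.conjE1] bd_derives.cut[OF bd_derives.conjE2]])

lemma bd_disj_mono: "\<phi> \<turnstile>\<^sub>B\<^sub>D \<phi>' \<Longrightarrow> \<psi> \<turnstile>\<^sub>B\<^sub>D \<psi>' \<Longrightarrow> BOr \<phi> \<psi> \<turnstile>\<^sub>B\<^sub>D BOr \<phi>' \<psi>'"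
  by (rule bd_derives.disjE[OF bd_derives.cut[OF _ bd_derives.disjI1] bd_derives.cut[OF _ bd_derives.disjI2]])

lemma bd_conj_comm: "BAnd \<phi> \<psi> \<turnstile>\<^sub>B\<^sub>D BAnd \<psi> \<phi>"
  by (rule bd_derives.conjI[OF bd_derives.conjE2 bd_derives.conjE1])

lemma bd_sound:
  "\<phi> \<turnstile>\<^sub>B\<^sub>D \<psi> \<Longrightarrow> supp_pos vp vm \<phi> \<subseteq> supp_pos vp vm \<psi> \<and> supp_neg vp vm \<psi> \<subseteq> supp_neg vp vm \<phi>"
  by (induction rule: bd_derives.induct) auto

text \<open>Stated by its universal property, so that no enumeration of F has to be chosen.
  Belnap--Dunn logic has no constants, hence F must be nonempty.\<close>

lemma ex_finite_meet:
  assumes "finite F" "F \<noteq> {}"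
  shows "\<exists>\<psi>. (\<forall>\<phi>\<in>F. \<psi> \<turnstile>\<^sub>B\<^sub>D \<phi>) \<and> (\<forall>\<xi>. (\<forall>\<phi>\<in>F. \<xi> \<turnstile>\<^sub>B\<^sub>D \<phi>) \<longrightarrow> \<xi> \<turnstile>\<^sub>B\<^sub>D \<psi>)"
  using assms
proof (induction F rule: finite_ne_induct)
  case (singleton \<phi>)
  then show ?case by (auto intro: exI[of _ \<phi>] bd_refl)
next
  case (insert \<phi> F)
  then obtain \<psi> where \<psi>: "\<forall>\<theta>\<in>F. \<psi> \<turnstile>\<^sub>B\<^sub>D \<theta>" "\<forall>\<xi>. (\<forall>\<theta>\<in>F. \<xi> \<turnstile>\<^sub>B\<^sub>D \<theta>) \<longrightarrow> \<xi> \<turnstile>\<^sub>B\<^sub>D \<psi>" by blast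
  show ?case
    by (rule exI[of _ "BAnd \<phi> \<psi>"])
      (auto intro: bd_derives.conjE1 bd_derives.conjI \<psi>(2)[rule_format]
        bd_derives.cut[OF bd_derives.conjE2 \<psi>(1)[rule_format]])
qed

text \<open>Leastness is demanded under every conjunct \<xi>, so distributivity is absorbed into
  this one induction.\<close>

lemma ex_finite_join:
  assumes "finite F" "F \<noteq> {}"
  shows "\<exists>\<psi>. (\<forall>\<phi>\<in>F. \<phi> \<turnstile>\<^sub>B\<^sub>D \<psi>) \<and>
    (\<forall>\<xi> \<theta>. (\<forall>\<phi>\<in>F. BAnd \<xi> \<phi> \<turnstile>\<^sub>B\<^sub>D \<theta>) \<longrightarrow> BAnd \<xi> \<psi> \<turnstile>\<^sub>B\<^sub>D \<theta>)"
  using assms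
proof (induction F rule: finite_ne_induct)
  case (singleton \<phi>)
  then show ?case by (auto intro: exI[of _ \<phi>] bd_refl)
next
  case (insert \<phi> F)
  then obtain \<psi> where \<psi>: "\<forall>\<theta>\<in>F. \<theta> \<turnstile>\<^sub>B\<^sub>D \<psi>"
    "\<forall>\<xi> \<theta>. (\<forall>\<phi>\<in>F. BAnd \<xi> \<phi> \<turnstile>\<^sub>B\<^sub>D \<theta>) \<longrightarrow> BAnd \<xi> \<psi> \<turnstile>\<^sub>B\<^sub>D \<theta>" by blast
  show ?case
    by (rule exI[of _ "BOr \<phi> \<psi>"])
      (auto intro: bd_derives.disjI1 bd_derives.disjE \<psi>(2)[rule_format]
        bd_derives.cut[OF \<psi>(1)[rule_format] bd_derives.disjI2] bd_derives.cut[OF bd_derives.distrib])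
qed

definition big_meet :: "'p bd set \<Rightarrow> 'p bd" where
  "big_meet F = (SOME \<psi>. (\<forall>\<phi>\<in>F. \<psi> \<turnstile>\<^sub>B\<^sub>D \<phi>) \<and> (\<forall>\<xi>. (\<forall>\<phi>\<in>F. \<xi> \<turnstile>\<^sub>B\<^sub>D \<phi>) \<longrightarrow> \<xi> \<turnstile>\<^sub>B\<^sub>D \<psi>))"

definition big_join :: "'p bd set \<Rightarrow> 'p bd" where
  "big_join F = (SOME \<psi>. (\<forall>\<phi>\<in>F. \<phi> \<turnstile>\<^sub>B\<^sub>D \<psi>) \<and>
    (\<forall>\<xi> \<theta>. (\<forall>\<phi>\<in>F. BAnd \<xi> \<phi> \<turnstile>\<^sub>B\<^sub>D \<theta>) \<longrightarrow> BAnd \<xi> \<psi> \<turnstile>\<^sub>B\<^sub>D \<theta>))"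

lemma big_meet_lower: "finite F \<Longrightarrow> \<phi> \<in> F \<Longrightarrow> big_meet F \<turnstile>\<^sub>B\<^sub>D \<phi>"
  using someI_ex[OF ex_finite_meet[of F]] unfolding big_meet_def by blast

lemma big_meet_greatest:
  "finite F \<Longrightarrow> F \<noteq> {} \<Longrightarrow> (\<And>\<phi>. \<phi> \<in> F \<Longrightarrow> \<xi> \<turnstile>\<^sub>B\<^sub>D \<phi>) \<Longrightarrow> \<xi> \<turnstile>\<^sub>B\<^sub>D big_meet F"
  using someI_ex[OF ex_finite_meet[of F]] unfolding big_meet_def by blast

lemma big_join_upper: "finite F \<Longrightarrow> \<phi> \<in> F \<Longrightarrow> \<phi> \<turnstile>\<^sub>B\<^sub>D big_join F"
  using someI_ex[OF ex_finite_join[of F]] unfolding big_join_def by blast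

lemma big_join_distrib_least:
  "finite F \<Longrightarrow> F \<noteq> {} \<Longrightarrow> (\<And>\<phi>. \<phi> \<in> F \<Longrightarrow> BAnd \<xi> \<phi> \<turnstile>\<^sub>B\<^sub>D \<theta>) \<Longrightarrow> BAnd \<xi> (big_join F) \<turnstile>\<^sub>B\<^sub>D \<theta>"
  using someI_ex[OF ex_finite_join[of F]] unfolding big_join_def by blast

lemma big_join_least:
  assumes "finite F" "F \<noteq> {}" "\<And>\<phi>. \<phi> \<in> F \<Longrightarrow> \<phi> \<turnstile>\<^sub>B\<^sub>D \<theta>"
  shows "big_join F \<turnstile>\<^sub>B\<^sub>D \<theta>"
  \<comment> \<open>The context \<xi> is taken to be the join itself, duplicated by conjunction
    introduction.\<close>
  by (rule bd_derives.cut[OF bd_derives.conjI[OF bd_refl bd_refl] big_join_distrib_least[OF assms(1,2)]])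
    (rule bd_derives.cut[OF bd_derives.conjE2 assms(3)])

text \<open>A state of the canonical frame is the set of literals it supports. The empty state supports no
  formula at all; it is left out of \<open>states\<close> and only absorbs the remaining probability mass.\<close>

abbreviation canon_pos :: "'p bd \<Rightarrow> ('p \<times> bool) set set" where
  "canon_pos \<equiv> supp_pos (\<lambda>x. {S. (x, True) \<in> S}) (\<lambda>x. {S. (x, False) \<in> S})"

abbreviation canon_neg :: "'p bd \<Rightarrow> ('p \<times> bool) set set" where
  "canon_neg \<equiv> supp_neg (\<lambda>x. {S. (x, True) \<in> S}) (\<lambda>x. {S. (x, False) \<in> S})"

definition states :: "'p set \<Rightarrow> ('p \<times> bool) set set" where
  "states V = Pow (V \<times> UNIV) - {{}}"

fun literal :: "'p \<times> bool \<Rightarrow> 'p bd" where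
  "literal (x, b) = (if b then BVar x else BNeg (BVar x))"

definition minterm :: "('p \<times> bool) set \<Rightarrow> 'p bd" where
  "minterm S = big_meet (literal ` S)"

definition normal_form :: "('p \<times> bool) set set \<Rightarrow> 'p bd" where
  "normal_form U = big_join (minterm ` U)"

text \<open>The shape of canonical supports: the empty state supports nothing and the full state
  everything, hence no empty U and no empty member. In particular normal forms never take an empty
  join or meet.\<close>

definition upset :: "'a set \<Rightarrow> 'a set set \<Rightarrow> bool" where
  "upset L U \<longleftrightarrow> U \<noteq> {} \<and> U \<subseteq> Pow L - {{}} \<and> (\<forall>S\<in>U. \<forall>S'. S \<subseteq> S' \<longrightarrow> S' \<subseteq> L \<longrightarrow> S' \<in> U)"

lemma upset_top: "upset L U \<Longrightarrow> L \<in> U"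
  unfolding upset_def by (metis DiffD1 PowD ex_in_conv order_refl subsetD)

lemma upset_closed: "upset L U \<Longrightarrow> S \<in> U \<Longrightarrow> S \<subseteq> S' \<Longrightarrow> S' \<subseteq> L \<Longrightarrow> S' \<in> U"
  unfolding upset_def by blast

lemma upset_subset: "upset L U \<Longrightarrow> U \<subseteq> Pow L - {{}}"
  unfolding upset_def by blast

lemma upsetI:
  "L \<in> U \<Longrightarrow> U \<subseteq> Pow L - {{}} \<Longrightarrow>
    (\<And>S S'. S \<in> U \<Longrightarrow> S \<subseteq> S' \<Longrightarrow> S' \<subseteq> L \<Longrightarrow> S' \<in> U) \<Longrightarrow> upset L U"
  unfolding upset_def by auto

lemma upset_inter:
  assumes "upset L U" "upset L U'" shows "upset L (U \<inter> U')"
proof (rule upsetI)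
  show "L \<in> U \<inter> U'" using assms upset_top by auto
  show "U \<inter> U' \<subseteq> Pow L - {{}}" using upset_subset[OF assms(1)] by auto
qed (use upset_closed[OF assms(1)] upset_closed[OF assms(2)] in auto)

lemma upset_union:
  assumes "upset L U" "upset L U'" shows "upset L (U \<union> U')"
proof (rule upsetI)
  show "L \<in> U \<union> U'" using upset_top[OF assms(1)] by auto
  show "U \<union> U' \<subseteq> Pow L - {{}}" using upset_subset[OF assms(1)] upset_subset[OF assms(2)] by auto
qed (use upset_closed[OF assms(1)] upset_closed[OF assms(2)] in auto)

lemma canon_up:
  "S \<subseteq> S' \<Longrightarrow> (S \<in> canon_pos \<phi> \<longrightarrow> S' \<in> canon_pos \<phi>) \<and> (S \<in> canon_neg \<phi> \<longrightarrow> S' \<in> canon_neg \<phi>)"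
  by (induction \<phi>) auto

lemma canon_empty: "{} \<notin> canon_pos \<phi> \<and> {} \<notin> canon_neg \<phi>"
  by (induction \<phi>) auto

lemma canon_full:
  "set_bd \<phi> \<subseteq> V \<Longrightarrow> V \<times> UNIV \<in> canon_pos \<phi> \<and> V \<times> UNIV \<in> canon_neg \<phi>"
  by (induction \<phi>) auto

lemma set_bd_ne: "set_bd \<phi> \<noteq> {}"
  by (induction \<phi>) auto

lemma upset_canon:
  assumes "set_bd \<phi> \<subseteq> V"
  shows "upset (V \<times> UNIV) (canon_pos \<phi> \<inter> states V)" "upset (V \<times> UNIV) (canon_neg \<phi> \<inter> states V)"
proof -
  have ne: "V \<times> (UNIV :: bool set) \<in> states V" using set_bd_ne[of \<phi>] assms by (auto simp: states_def)
  have "upset (V \<times> UNIV) (A \<inter> states V)"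
    if "V \<times> UNIV \<in> A" "\<And>S S'. S \<in> A \<Longrightarrow> S \<subseteq> S' \<Longrightarrow> S' \<in> A" for A :: "('a \<times> bool) set set"
  proof (rule upsetI)
    fix S S' assume "S \<in> A \<inter> states V" "S \<subseteq> S'" "S' \<subseteq> V \<times> UNIV"
    then show "S' \<in> A \<inter> states V" using that(2)[of S S'] by (auto simp: states_def)
  qed (use that(1) ne in \<open>auto simp: states_def\<close>)
  note * = this
  show "upset (V \<times> UNIV) (canon_pos \<phi> \<inter> states V)" "upset (V \<times> UNIV) (canon_neg \<phi> \<inter> states V)"
    by (rule *, simp add: canon_full[OF assms], use canon_up in blast)+
qed

section \<open>Disjunctive normal forms over finitely many variables\<close>

context
  fixes V :: "'p set"
  assumes fin: "finite V"
begin

lemma finite_states: "finite (states V)"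
  using fin by (auto simp: states_def)

lemma finite_state: "S \<in> states V \<Longrightarrow> finite S"
  using fin by (auto simp: states_def intro: finite_subset[of S "V \<times> UNIV"])

lemma finite_upset: "upset (V \<times> (UNIV :: bool set)) U \<Longrightarrow> finite U"
  by (rule finite_subset[OF _ finite_states]) (auto simp: upset_def states_def)

lemma minterm_literal: "S \<in> states V \<Longrightarrow> l \<in> S \<Longrightarrow> minterm S \<turnstile>\<^sub>B\<^sub>D literal l"
  unfolding minterm_def by (intro big_meet_lower finite_imageI finite_state imageI)

lemma minterm_greatest:
  "S \<in> states V \<Longrightarrow> (\<And>l. l \<in> S \<Longrightarrow> \<xi> \<turnstile>\<^sub>B\<^sub>D literal l) \<Longrightarrow> \<xi> \<turnstile>\<^sub>B\<^sub>D minterm S"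
  unfolding minterm_def by (intro big_meet_greatest finite_imageI finite_state) (auto simp: states_def)

lemma minterm_union:
  assumes "S \<in> states V" "S' \<in> states V"
  shows "BAnd (minterm S) (minterm S') \<turnstile>\<^sub>B\<^sub>D minterm (S \<union> S')"
proof (rule minterm_greatest)
  show "S \<union> S' \<in> states V" using assms by (auto simp: states_def)
  fix l assume "l \<in> S \<union> S'"
  then show "BAnd (minterm S) (minterm S') \<turnstile>\<^sub>B\<^sub>D literal l"
  proof
    assume "l \<in> S"
    from bd_derives.cut[OF bd_derives.conjE1 minterm_literal[OF assms(1) this]] show ?thesis .
  next
    assume "l \<in> S'"
    from bd_derives.cut[OF bd_derives.conjE2 minterm_literal[OF assms(2) this]] show ?thesis .
  qed
qed

lemma minterm_normal_form: "upset (V \<times> UNIV) U \<Longrightarrow> S \<in> U \<Longrightarrow> minterm S \<turnstile>\<^sub>B\<^sub>D normal_form U"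
  unfolding normal_form_def by (intro big_join_upper finite_imageI finite_upset imageI)

lemma normal_form_least:
  "upset (V \<times> UNIV) U \<Longrightarrow> (\<And>S. S \<in> U \<Longrightarrow> minterm S \<turnstile>\<^sub>B\<^sub>D \<theta>) \<Longrightarrow> normal_form U \<turnstile>\<^sub>B\<^sub>D \<theta>"
  unfolding normal_form_def by (intro big_join_least finite_imageI finite_upset) (auto simp: upset_def)

lemma normal_form_distrib_least:
  "upset (V \<times> UNIV) U \<Longrightarrow> (\<And>S. S \<in> U \<Longrightarrow> BAnd \<xi> (minterm S) \<turnstile>\<^sub>B\<^sub>D \<theta>) \<Longrightarrow>
    BAnd \<xi> (normal_form U) \<turnstile>\<^sub>B\<^sub>D \<theta>"
  unfolding normal_form_def
  by (intro big_join_distrib_least finite_imageI finite_upset) (auto simp: upset_def)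

lemma normal_form_mono:
  "upset (V \<times> UNIV) U \<Longrightarrow> upset (V \<times> UNIV) U' \<Longrightarrow> U \<subseteq> U' \<Longrightarrow> normal_form U \<turnstile>\<^sub>B\<^sub>D normal_form U'"
  by (rule normal_form_least) (auto intro: minterm_normal_form)

lemma normal_form_union:
  assumes "upset (V \<times> UNIV) U" "upset (V \<times> UNIV) U'"
  shows "normal_form (U \<union> U') \<turnstile>\<^sub>B\<^sub>D BOr (normal_form U) (normal_form U')"
    and "BOr (normal_form U) (normal_form U') \<turnstile>\<^sub>B\<^sub>D normal_form (U \<union> U')"
proof -
  show "normal_form (U \<union> U') \<turnstile>\<^sub>B\<^sub>D BOr (normal_form U) (normal_form U')"
  proof (rule normal_form_least[OF upset_union[OF assms]])
    fix S assume "S \<in> U \<union> U'"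
    then show "minterm S \<turnstile>\<^sub>B\<^sub>D BOr (normal_form U) (normal_form U')"
    proof
      assume "S \<in> U"
      from bd_derives.cut[OF minterm_normal_form[OF assms(1) this] bd_derives.disjI1] show ?thesis .
    next
      assume "S \<in> U'"
      from bd_derives.cut[OF minterm_normal_form[OF assms(2) this] bd_derives.disjI2] show ?thesis .
    qed
  qed
  show "BOr (normal_form U) (normal_form U') \<turnstile>\<^sub>B\<^sub>D normal_form (U \<union> U')"
    by (rule bd_derives.disjE[OF normal_form_mono[OF assms(1) upset_union[OF assms]]
          normal_form_mono[OF assms(2) upset_union[OF assms]]]) auto
qed

text \<open>For the second half, distributivity reduces the conjunction to pairs of minterms; S and
  S' merge into S \<union> S', which lies in both upsets by upward closure.\<close>

lemma normal_form_inter: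
  assumes "upset (V \<times> UNIV) U" "upset (V \<times> UNIV) U'"
  shows "normal_form (U \<inter> U') \<turnstile>\<^sub>B\<^sub>D BAnd (normal_form U) (normal_form U')"
    and "BAnd (normal_form U) (normal_form U') \<turnstile>\<^sub>B\<^sub>D normal_form (U \<inter> U')"
proof -
  show "normal_form (U \<inter> U') \<turnstile>\<^sub>B\<^sub>D BAnd (normal_form U) (normal_form U')"
    by (rule bd_derives.conjI[OF normal_form_mono[OF upset_inter[OF assms] assms(1)]
          normal_form_mono[OF upset_inter[OF assms] assms(2)]]) auto
  have "BAnd (minterm S) (minterm S') \<turnstile>\<^sub>B\<^sub>D normal_form (U \<inter> U')" if "S \<in> U" "S' \<in> U'" for S S'
  proof -
    have V: "S \<subseteq> V \<times> UNIV" "S' \<subseteq> V \<times> UNIV" "S \<in> states V" "S' \<in> states V"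
      using that assms unfolding upset_def states_def by auto
    then have "S \<union> S' \<subseteq> V \<times> UNIV" by simp
    then have "S \<union> S' \<in> U" "S \<union> S' \<in> U'"
      using that upset_closed[OF assms(1), of S "S \<union> S'"] upset_closed[OF assms(2), of S' "S \<union> S'"] by auto
    then have "minterm (S \<union> S') \<turnstile>\<^sub>B\<^sub>D normal_form (U \<inter> U')"
      by (intro minterm_normal_form[OF upset_inter[OF assms]]) simp
    then show ?thesis by (rule bd_derives.cut[OF minterm_union[OF V(3,4)]])
  qed
  then have "BAnd (minterm S) (normal_form U') \<turnstile>\<^sub>B\<^sub>D normal_form (U \<inter> U')" if "S \<in> U" for S
    using that by (intro normal_form_distrib_least[OF assms(2)])
  then have "BAnd (normal_form U') (minterm S) \<turnstile>\<^sub>B\<^sub>D normal_form (U \<inter> U')" if "S \<in> U" for S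
    by (rule bd_derives.cut[OF bd_conj_comm]) (use that in simp)
  then have "BAnd (normal_form U') (normal_form U) \<turnstile>\<^sub>B\<^sub>D normal_form (U \<inter> U')"
    by (rule normal_form_distrib_least[OF assms(1)])
  then show "BAnd (normal_form U) (normal_form U') \<turnstile>\<^sub>B\<^sub>D normal_form (U \<inter> U')"
    by (rule bd_derives.cut[OF bd_conj_comm])
qed

text \<open>Truth and falsity are treated together because negation exchanges the two supports in
  the induction.\<close>

lemma minterm_canon:
  assumes "S \<in> states V"
  shows "(S \<in> canon_pos \<phi> \<longrightarrow> minterm S \<turnstile>\<^sub>B\<^sub>D \<phi>) \<and> (S \<in> canon_neg \<phi> \<longrightarrow> minterm S \<turnstile>\<^sub>B\<^sub>D BNeg \<phi>)"
proof (induction \<phi>)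
  case (BVar x)
  then show ?case using minterm_literal[OF assms, of "(x, True)"] minterm_literal[OF assms, of "(x, False)"]
    by auto
next
  case (BNeg \<phi>)
  have "minterm S \<turnstile>\<^sub>B\<^sub>D \<phi> \<Longrightarrow> minterm S \<turnstile>\<^sub>B\<^sub>D BNeg (BNeg \<phi>)" by (rule bd_derives.cut[OF _ bd_derives.dnegI])
  then show ?case using BNeg by simp
next
  case (BAnd \<phi> \<psi>)
  have "minterm S \<turnstile>\<^sub>B\<^sub>D BNeg \<phi> \<Longrightarrow> minterm S \<turnstile>\<^sub>B\<^sub>D BNeg (BAnd \<phi> \<psi>)"
    "minterm S \<turnstile>\<^sub>B\<^sub>D BNeg \<psi> \<Longrightarrow> minterm S \<turnstile>\<^sub>B\<^sub>D BNeg (BAnd \<phi> \<psi>)"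
    by (erule bd_derives.cut[OF _ bd_derives.contrapos], rule bd_derives.conjE1 bd_derives.conjE2)+
  moreover have "minterm S \<turnstile>\<^sub>B\<^sub>D \<phi> \<Longrightarrow> minterm S \<turnstile>\<^sub>B\<^sub>D \<psi> \<Longrightarrow> minterm S \<turnstile>\<^sub>B\<^sub>D BAnd \<phi> \<psi>"
    by (rule bd_derives.conjI)
  ultimately show ?case using BAnd by auto
next
  case (BOr \<phi> \<psi>)
  have "minterm S \<turnstile>\<^sub>B\<^sub>D \<phi> \<Longrightarrow> minterm S \<turnstile>\<^sub>B\<^sub>D BOr \<phi> \<psi>" "minterm S \<turnstile>\<^sub>B\<^sub>D \<psi> \<Longrightarrow> minterm S \<turnstile>\<^sub>B\<^sub>D BOr \<phi> \<psi>"
    by (erule bd_derives.cut, rule bd_derives.disjI1 bd_derives.disjI2)+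
  moreover have "minterm S \<turnstile>\<^sub>B\<^sub>D BNeg \<phi> \<Longrightarrow> minterm S \<turnstile>\<^sub>B\<^sub>D BNeg \<psi> \<Longrightarrow> minterm S \<turnstile>\<^sub>B\<^sub>D BNeg (BOr \<phi> \<psi>)"
    by (rule bd_derives.cut[OF bd_derives.conjI bd_derives.deMorgan_disj])
  ultimately show ?case using BOr by auto
qed

text \<open>With \<open>normal_form_canon\<close> it makes \<phi> interderivable with the normal
  form of its canonical support, so derivability over \<open>V\<close> is decided by finitely many
  upsets. The half about \<open>BNeg \<phi>\<close> carries the induction through negations.\<close>

lemma canon_normal_form:
  assumes "set_bd \<phi> \<subseteq> V"
  shows "\<phi> \<turnstile>\<^sub>B\<^sub>D normal_form (canon_pos \<phi> \<inter> states V) \<and>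
    BNeg \<phi> \<turnstile>\<^sub>B\<^sub>D normal_form (canon_neg \<phi> \<inter> states V)"
  using assms
proof (induction \<phi>)
  case (BVar x)
  have "literal (x, b) \<turnstile>\<^sub>B\<^sub>D normal_form U" if "{(x, b)} \<in> U" "upset (V \<times> UNIV) U" for b U
  proof (rule bd_derives.cut[OF minterm_greatest minterm_normal_form[OF that(2,1)]])
    show "{(x, b)} \<in> states V" using BVar by (auto simp: states_def)
  qed (use bd_refl in auto)
  from this[OF _ upset_canon(1)[OF BVar], of True] this[OF _ upset_canon(2)[OF BVar], of False]
  show ?case using BVar by (simp add: states_def)
next
  case (BNeg \<phi>)
  then have "\<phi> \<turnstile>\<^sub>B\<^sub>D normal_form (canon_pos \<phi> \<inter> states V)" by simp
  then have "BNeg (BNeg \<phi>) \<turnstile>\<^sub>B\<^sub>D normal_form (canon_pos \<phi> \<inter> states V)"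
    by (rule bd_derives.cut[OF bd_derives.dnegE])
  then show ?case using BNeg by simp
next
  case (BAnd \<phi> \<psi>)
  then have sub: "set_bd \<phi> \<subseteq> V" "set_bd \<psi> \<subseteq> V" by auto
  have eq: "canon_pos (BAnd \<phi> \<psi>) \<inter> states V = (canon_pos \<phi> \<inter> states V) \<inter> (canon_pos \<psi> \<inter> states V)"
    "canon_neg (BAnd \<phi> \<psi>) \<inter> states V = (canon_neg \<phi> \<inter> states V) \<union> (canon_neg \<psi> \<inter> states V)"
    by auto
  note IH = conjunct1[OF BAnd.IH(1)[OF sub(1)]] conjunct1[OF BAnd.IH(2)[OF sub(2)]]
    conjunct2[OF BAnd.IH(1)[OF sub(1)]] conjunct2[OF BAnd.IH(2)[OF sub(2)]]
  show ?case unfolding eq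
    using bd_derives.cut[OF bd_conj_mono[OF IH(1,2)] normal_form_inter(2)[OF upset_canon(1)[OF sub(1)] upset_canon(1)[OF sub(2)]]]
      bd_derives.cut[OF bd_derives.deMorgan_conj bd_derives.cut[OF bd_disj_mono[OF IH(3,4)]
          normal_form_union(2)[OF upset_canon(2)[OF sub(1)] upset_canon(2)[OF sub(2)]]]]
    by (rule HOL.conjI)
next
  case (BOr \<phi> \<psi>)
  then have sub: "set_bd \<phi> \<subseteq> V" "set_bd \<psi> \<subseteq> V" by auto
  have eq: "canon_pos (BOr \<phi> \<psi>) \<inter> states V = (canon_pos \<phi> \<inter> states V) \<union> (canon_pos \<psi> \<inter> states V)"
    "canon_neg (BOr \<phi> \<psi>) \<inter> states V = (canon_neg \<phi> \<inter> states V) \<inter> (canon_neg \<psi> \<inter> states V)"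
    by auto
  note IH = conjunct1[OF BOr.IH(1)[OF sub(1)]] conjunct1[OF BOr.IH(2)[OF sub(2)]]
    conjunct2[OF BOr.IH(1)[OF sub(1)]] conjunct2[OF BOr.IH(2)[OF sub(2)]]
  have "BNeg (BOr \<phi> \<psi>) \<turnstile>\<^sub>B\<^sub>D BAnd (BNeg \<phi>) (BNeg \<psi>)"
    by (rule bd_derives.conjI[OF bd_derives.contrapos[OF bd_derives.disjI1]
          bd_derives.contrapos[OF bd_derives.disjI2]])
  from bd_derives.cut[OF bd_disj_mono[OF IH(1,2)] normal_form_union(2)[OF upset_canon(1)[OF sub(1)] upset_canon(1)[OF sub(2)]]]
    bd_derives.cut[OF this bd_derives.cut[OF bd_conj_mono[OF IH(3,4)]
          normal_form_inter(2)[OF upset_canon(2)[OF sub(1)] upset_canon(2)[OF sub(2)]]]]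
  show ?case unfolding eq by (rule HOL.conjI)
qed

lemma normal_form_canon:
  assumes "set_bd \<phi> \<subseteq> V"
  shows "normal_form (canon_pos \<phi> \<inter> states V) \<turnstile>\<^sub>B\<^sub>D \<phi>"
  by (rule normal_form_least[OF upset_canon(1)[OF assms]]) (use minterm_canon in auto)

end

text \<open>Moebius inversion: the weight of \<open>S\<close> is the increment of \<open>g\<close> when \<open>S\<close> is added to the states
  strictly above it.\<close>

lemma modular_is_additive:
  fixes g :: "'a set set \<Rightarrow> real"
  assumes "finite L" "L \<noteq> {}"
    and mono: "\<And>U U'. upset L U \<Longrightarrow> upset L U' \<Longrightarrow> U \<subseteq> U' \<Longrightarrow> g U \<le> g U'"
    and modular: "\<And>U U'. upset L U \<Longrightarrow> upset L U' \<Longrightarrow> g (U \<union> U') + g (U \<inter> U') = g U + g U'"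
    and bounds: "\<And>U. upset L U \<Longrightarrow> 0 \<le> g U \<and> g U \<le> 1"
  obtains p where "\<And>S. S \<in> Pow L \<Longrightarrow> 0 \<le> p S" "(\<Sum>S\<in>Pow L. p S) = 1"
    "\<And>U. upset L U \<Longrightarrow> g U = (\<Sum>S\<in>U. p S)"
proof -
  define up where "up S = {S'. S \<subseteq> S' \<and> S' \<subseteq> L}" for S
  \<comment> \<open>For S = L removing S would leave the empty set, which is no upset, so L receives
    g {L} directly.\<close>
  define p where "p S = (if S = {} then 1 - g (Pow L - {{}}) else if S = L then g {L}
    else g (up S) - g (up S - {S}))" for S
  have up_L: "upset L {L}" using assms(2) by (auto simp: upset_def)
  have up_all: "upset L (Pow L - {{}})" using assms(2) by (auto simp: upset_def)
  have up_up: "upset L (up S)" "upset L (up S - {S})" if "S \<subseteq> L" "S \<noteq> {}" "S \<noteq> L" for S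
    using that unfolding upset_def up_def by auto
  have add: "g U = (\<Sum>S\<in>U. p S)" if "upset L U" for U
    using that
  proof (induction "card U" arbitrary: U rule: less_induct)
    case less
    have "U \<subseteq> Pow L" using less.prems by (auto simp: upset_def)
    then have fin: "finite U" using assms(1) by (auto intro: finite_subset)
    have "L \<in> U" using less.prems by (rule upset_top)
    show ?case
    proof (cases "U = {L}")
      case True
      then show ?thesis using assms(2) by (simp add: p_def)
    next
      case False
      then obtain T where T: "T \<in> U - {L}" using \<open>L \<in> U\<close> by blast
      \<comment> \<open>Removing a minimal S keeps U an upset. U is the union of U - {S} and
        \<open>up S\<close>, which meet in \<open>up S - {S}\<close>, so modularity yields exactly
        the increment p S.\<close>
      obtain S where S: "S \<in> U - {L}" and min: "\<And>S'. S' \<in> U - {L} \<Longrightarrow> S' \<subseteq> S \<Longrightarrow> S' = S"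
        using finite_has_minimal[of "U - {L}"] fin T by blast
      have SL: "S \<subseteq> L" "S \<noteq> {}" "S \<noteq> L" using S less.prems unfolding upset_def by auto
      have min': "S' = S" if "S' \<in> U" "S' \<subseteq> S" for S'
        using min[of S'] that SL by auto
      have up': "upset L (U - {S})"
    proof (rule upsetI)
      fix S1 S2 assume *: "S1 \<in> U - {S}" "S1 \<subseteq> S2" "S2 \<subseteq> L"
      then have "S2 \<in> U" using upset_closed[OF less.prems, of S1 S2] by simp
      then show "S2 \<in> U - {S}" using * min'[of S1] by auto
    qed (use \<open>L \<in> U\<close> SL upset_subset[OF less.prems] in auto)
      have "U = (U - {S}) \<union> up S" "(U - {S}) \<inter> up S = up S - {S}"
        using upset_closed[OF less.prems, of S] upset_subset[OF less.prems] S unfolding up_def by auto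
      then have "g U + g (up S - {S}) = g (U - {S}) + g (up S)"
        using modular[OF up' up_up(1)[OF SL]] by simp
      moreover have "g (U - {S}) = (\<Sum>S\<in>U - {S}. p S)"
        using S fin by (intro less.hyps[OF _ up'] card_Diff1_less) auto
      moreover have "(\<Sum>S\<in>U. p S) = p S + (\<Sum>S\<in>U - {S}. p S)"
        using S fin by (intro sum.remove) auto
      ultimately show ?thesis using SL by (simp add: p_def)
    qed
  qed
  show thesis
  proof (rule that[of p])
    show "0 \<le> p S" if "S \<in> Pow L" for S
      using that bounds[OF up_L] bounds[OF up_all] mono[OF up_up(2,1), of S] unfolding p_def by auto
    show "(\<Sum>S\<in>Pow L. p S) = 1"
      using add[OF up_all] assms(1) by (simp add: sum.remove[of "Pow L" "{}"] p_def)
  qed (rule add)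
qed

text \<open>Any infinite type has room for the finitely many sets of literals. The remaining points
  support no formula and get measure zero; a probability mass function makes every set of states
  measurable.\<close>

lemma realize_in_model:
  fixes p :: "('p \<times> bool) set \<Rightarrow> real"
  assumes "finite L" "\<And>S. S \<in> Pow L \<Longrightarrow> 0 \<le> p S" "(\<Sum>S\<in>Pow L. p S) = 1"
  obtains vp vm and P :: "'w::infinite measure" where "prob_bd_model UNIV vp vm P"
    "\<And>\<phi>. measure P (supp_pos vp vm \<phi>) = (\<Sum>S\<in>canon_pos \<phi> \<inter> Pow L. p S)"
    "\<And>\<phi>. measure P (supp_neg vp vm \<phi>) = (\<Sum>S\<in>canon_neg \<phi> \<inter> Pow L. p S)"
proof -
  define p' where "p' S = (if S \<in> Pow L then p S else 0)" for S
  have fin: "finite (Pow L)" using assms(1) by simp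
  have nonneg: "0 \<le> p' S" for S using assms(2) by (auto simp: p'_def)
  have sum: "sum p' A = (\<Sum>S\<in>A \<inter> Pow L. p S)" if "finite A" for A
    unfolding p'_def using that by (simp add: sum.If_cases Int_def)
  have "(\<integral>\<^sup>+ S. ennreal (p' S) \<partial>count_space UNIV) = (\<integral>\<^sup>+ S. ennreal (p' S) \<partial>count_space (Pow L))"
    by (rule nn_integral_count_space_eq) (auto simp: p'_def)
  also have "\<dots> = (\<Sum>S\<in>Pow L. ennreal (p' S))" using fin by (rule nn_integral_count_space_finite)
  also have "\<dots> = ennreal (\<Sum>S\<in>Pow L. p' S)" using nonneg by (simp add: sum_ennreal)
  also have "(\<Sum>S\<in>Pow L. p' S) = 1" using sum[OF fin] assms(3) by simp
  finally have "(\<integral>\<^sup>+ S. ennreal (p' S) \<partial>count_space UNIV) = 1" by simp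
  then have pmf: "pmf (embed_pmf p') S = p' S" for S by (rule pmf_embed_pmf[OF nonneg])
  obtain A :: "'w set" where A: "finite A" "card A = card (Pow L)"
    using infinite_arbitrarily_large[OF infinite_UNIV] by blast
  then obtain enc where enc: "bij_betw enc (Pow L) A"
    using finite_same_card_bij[OF fin A(1)] by auto
  define vp vm where "vp x = enc ` {S \<in> Pow L. (x, True) \<in> S}"
    and "vm x = enc ` {S \<in> Pow L. (x, False) \<in> S}" for x
  have inj: "inj_on enc (Pow L)" using enc by (rule bij_betw_imp_inj_on)
  have supp: "supp_pos vp vm \<phi> = enc ` (canon_pos \<phi> \<inter> Pow L) \<and>
      supp_neg vp vm \<phi> = enc ` (canon_neg \<phi> \<inter> Pow L)" for \<phi>
  proof (induction \<phi>)
    case (BVar x)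
    show ?case by (auto simp: vp_def vm_def)
  next
    case (BAnd \<phi> \<psi>)
    have "enc ` (canon_pos \<phi> \<inter> Pow L) \<inter> enc ` (canon_pos \<psi> \<inter> Pow L) =
        enc ` ((canon_pos \<phi> \<inter> Pow L) \<inter> (canon_pos \<psi> \<inter> Pow L))"
      by (rule inj_on_image_Int[OF inj, symmetric]) auto
    then show ?case using BAnd by (auto simp: image_Un Int_Un_distrib2 Int_ac)
  next
    case (BOr \<phi> \<psi>)
    have "enc ` (canon_neg \<phi> \<inter> Pow L) \<inter> enc ` (canon_neg \<psi> \<inter> Pow L) =
        enc ` ((canon_neg \<phi> \<inter> Pow L) \<inter> (canon_neg \<psi> \<inter> Pow L))"
      by (rule inj_on_image_Int[OF inj, symmetric]) auto
    then show ?case using BOr by (auto simp: image_Un Int_Un_distrib2 Int_ac)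
  qed simp
  define P where "P = measure_pmf (map_pmf enc (embed_pmf p'))"
  have set: "set_pmf (embed_pmf p') \<subseteq> Pow L"
    using pmf by (auto simp: set_pmf_iff p'_def split: if_splits)
  have "measure P (enc ` (B \<inter> Pow L)) = (\<Sum>S\<in>B \<inter> Pow L. p S)" for B
  proof -
    have "(enc -` enc ` (B \<inter> Pow L)) \<inter> set_pmf (embed_pmf p') = (B \<inter> Pow L) \<inter> set_pmf (embed_pmf p')"
      using set inj unfolding inj_on_def by blast
    then have "measure P (enc ` (B \<inter> Pow L)) = measure (embed_pmf p') (B \<inter> Pow L)"
      unfolding P_def measure_map_pmf by (metis measure_Int_set_pmf)
    also have "\<dots> = sum p' (B \<inter> Pow L)"
      using fin by (simp add: measure_measure_pmf_finite pmf)
    finally show ?thesis using fin by (simp add: sum Int_assoc)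
  qed
  then show thesis
    using that[of vp vm P] supp unfolding prob_bd_model_def P_def
    by (simp add: measure_pmf.prob_space_axioms)
qed

section \<open>Soundness\<close>

definition unit_square :: "(real \<times> real) set" where
  "unit_square = {0..1} \<times> {0..1}"

lemma L2_closed:
  "a \<in> unit_square \<Longrightarrow> L2_neg a \<in> unit_square"
  "a \<in> unit_square \<Longrightarrow> L2_tilde a \<in> unit_square"
  "a \<in> unit_square \<Longrightarrow> L2_delta a \<in> unit_square"
  "a \<in> unit_square \<Longrightarrow> b \<in> unit_square \<Longrightarrow> L2_imp a b \<in> unit_square"
  by (cases a; cases b; auto simp: unit_square_def delta_L_def)+

text \<open>Reduces the check of every biconditional axiom to an equation between values.\<close>

lemma L2_iff_designated:
  assumes "a \<in> unit_square" "b \<in> unit_square"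
  shows "L2_tilde (L2_imp (L2_imp a b) (L2_tilde (L2_imp b a))) = (1, 0) \<longleftrightarrow> a = b"
  using assms by (cases a; cases b) (auto simp: unit_square_def min_def max_def split: if_splits)

lemma outer_val_closed:
  assumes "prob_bd_model W vp vm P"
  shows "outer_val vp vm P \<alpha> \<in> unit_square"
proof -
  interpret prob_space P using assms by (simp add: prob_bd_model_def)
  show ?thesis
    by (induction \<alpha>) (auto simp: unit_square_def intro: L2_closed[unfolded unit_square_def])
qed

lemma L2_axiom_sound:
  assumes "prob_bd_model W vp vm P" "L2_axiom \<alpha>"
  shows "outer_val vp vm P \<alpha> = (1, 0)"
proof -
  note closed = outer_val_closed[OF assms(1)]
  have iff: "outer_val vp vm P (\<alpha> \<^bold>\<leftrightarrow> \<beta>) = (1, 0) \<longleftrightarrow> outer_val vp vm P \<alpha> = outer_val vp vm P \<beta>"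
    for \<alpha> \<beta> using L2_iff_designated[OF closed closed] by simp
  have val: "\<exists>a b. outer_val vp vm P \<alpha> = (a, b) \<and> 0 \<le> a \<and> a \<le> 1 \<and> 0 \<le> b \<and> b \<le> 1" for \<alpha>
    using closed[of \<alpha>] unfolding unit_square_def by auto
  show ?thesis
    using assms(2)
  proof cases
    case (w \<beta> \<gamma>)
    then show ?thesis using val[of \<beta>] val[of \<gamma>] by auto
  next
    case (sf \<beta> \<gamma> \<delta>)
    then show ?thesis using val[of \<beta>] val[of \<gamma>] val[of \<delta>] by (auto simp: min_def max_def)
  next
    case (waj \<beta> \<gamma>)
    then show ?thesis using val[of \<beta>] val[of \<gamma>] by (auto simp: min_def max_def)
  next
    case (co \<beta> \<gamma>)
    then show ?thesis using val[of \<beta>] val[of \<gamma>] by (auto simp: min_def max_def)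
  next
    case (delta1 \<beta>)
    then show ?thesis using val[of \<beta>] by (auto simp: delta_L_def)
  next
    case (delta2 \<beta>)
    then show ?thesis using val[of \<beta>] by (auto simp: delta_L_def)
  next
    case (delta3 \<beta>)
    then show ?thesis using val[of \<beta>] by (auto simp: delta_L_def)
  next
    case (delta4 \<beta> \<gamma>)
    then show ?thesis using val[of \<beta>] val[of \<gamma>] by (auto simp: delta_L_def min_def max_def)
  next
    case (delta5 \<beta> \<gamma>)
    then show ?thesis using val[of \<beta>] val[of \<gamma>] by (auto simp: delta_L_def min_def max_def)
  next
    case (neg \<beta>)
    then show ?thesis unfolding neg iff using val[of \<beta>] by auto
  next
    case (deM_tilde \<beta>)
    then show ?thesis unfolding deM_tilde iff using val[of \<beta>] by auto
  next
    case (deM_imp \<beta> \<gamma>)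
    then show ?thesis unfolding deM_imp iff using val[of \<beta>] val[of \<gamma>] by (auto simp: min_def max_def)
  next
    case (deM_delta \<beta>)
    then show ?thesis unfolding deM_delta iff using val[of \<beta>] by (auto simp: delta_L_def)
  qed
qed

lemma modal_axiom_sound:
  assumes "prob_bd_model W vp vm P" "modal_axiom \<alpha>"
  shows "outer_val vp vm P \<alpha> = (1, 0)"
proof -
  interpret prob_space P using assms by (simp add: prob_bd_model_def)
  have sets: "A \<subseteq> W \<Longrightarrow> A \<in> sets P" for A using assms by (auto simp: prob_bd_model_def)
  have "supp_pos vp vm \<phi> \<subseteq> W \<and> supp_neg vp vm \<phi> \<subseteq> W" for \<phi>
    using assms(1) unfolding prob_bd_model_def by (induction \<phi>) auto
  then have pos: "supp_pos vp vm \<phi> \<in> sets P" and neg: "supp_neg vp vm \<phi> \<in> sets P" for \<phi>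
    using sets by auto
  note closed = outer_val_closed[OF assms(1)]
  have iff: "outer_val vp vm P (\<alpha> \<^bold>\<leftrightarrow> \<beta>) = (1, 0) \<longleftrightarrow> outer_val vp vm P \<alpha> = outer_val vp vm P \<beta>"
    for \<alpha> \<beta> using L2_iff_designated[OF closed closed] by simp
  have union: "prob (A \<union> B) = prob A + prob B - prob (A \<inter> B) \<and> prob (A \<inter> B) \<le> prob A \<and>
      0 \<le> prob (A \<inter> B) \<and> prob (A \<union> B) \<le> 1 \<and> prob A \<le> prob (A \<union> B)"
    if "A \<in> sets P" "B \<in> sets P" for A B
    using that finite_measure_Union'[of A B] finite_measure_Diff'[of B A] prob_le_1[of "A \<union> B"]
    by (auto simp: Int_commute intro!: finite_measure_mono)
  show ?thesis
    using assms(2)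
  proof cases
    case (mono \<phi> \<psi>)
    from bd_sound[OF mono(2), of vp vm]
    have "prob (supp_pos vp vm \<phi>) \<le> prob (supp_pos vp vm \<psi>)"
      "prob (supp_neg vp vm \<psi>) \<le> prob (supp_neg vp vm \<phi>)"
      by (auto intro!: finite_measure_mono pos neg)
    then show ?thesis by (simp add: mono(1))
  next
    case (neg \<phi>)
    show ?thesis unfolding neg iff by simp
  next
    case (incl_excl \<phi> \<psi>)
    \<comment> \<open>The side conditions say that no truncation takes effect. In the second
      components conjunction and disjunction change places: c' belongs to a union and v to an
      intersection.\<close>
    have arith: "(u, v) = L2_imp (L2_tilde (L2_tilde (L2_imp (a, a') (c, c')))) (b, b')"
      if "u = a + b - c" "c \<le> a" "u \<le> 1" "c' = a' + b' - v" "a' \<le> c'" "0 \<le> v"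
      for a a' b b' c c' u v :: real
      using that by (auto simp: min_def max_def)
    show ?thesis unfolding incl_excl iff unfolding outer_val.simps supp_pos.simps supp_neg.simps
      using union[OF pos[of \<phi>] pos[of \<psi>]] union[OF neg[of \<phi>] neg[of \<psi>]] by (intro arith) linarith+
  qed
qed

lemma pr_derives_sound:
  assumes "pr_derives \<Gamma> \<alpha>" "prob_bd_model W vp vm P" "\<And>\<gamma>. \<gamma> \<in> \<Gamma> \<Longrightarrow> outer_val vp vm P \<gamma> = (1, 0)"
  shows "outer_val vp vm P \<alpha> = (1, 0)"
  using assms(1)
proof induction
  case (mp \<alpha> \<beta>)
  then show ?case using outer_val_closed[OF assms(2), of \<beta>]
    by (cases "outer_val vp vm P \<beta>") (auto simp: unit_square_def min_def max_def split: if_splits)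
qed (simp_all add: assms(3) L2_axiom_sound[OF assms(2)] modal_axiom_sound[OF assms(2)] delta_L_def)

section \<open>Linear extensions\<close>

text \<open>Conflation is not among the closure conditions, since it would be incompatible with
  making the theory linear. Modal axioms and conflated premises come in through the theory that is
  extended.\<close>

definition delta_theory :: "'p outer set \<Rightarrow> bool" where
  "delta_theory T \<longleftrightarrow> (\<forall>\<alpha>. L2_axiom \<alpha> \<longrightarrow> \<alpha> \<in> T) \<and>
    (\<forall>\<alpha> \<beta>. \<alpha> \<in> T \<longrightarrow> \<alpha> \<^bold>\<rightarrow> \<beta> \<in> T \<longrightarrow> \<beta> \<in> T) \<and> (\<forall>\<alpha>\<in>T. \<^bold>\<triangle> \<alpha> \<in> T)"

lemma delta_theory_axiom: "delta_theory T \<Longrightarrow> L2_axiom \<alpha> \<Longrightarrow> \<alpha> \<in> T"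
  and delta_theory_nec: "delta_theory T \<Longrightarrow> \<alpha> \<in> T \<Longrightarrow> \<^bold>\<triangle> \<alpha> \<in> T"
  unfolding delta_theory_def by blast+

lemma delta_theory_lukasiewicz: "delta_theory T \<Longrightarrow> lukasiewicz_theory OImp OTilde T"
  unfolding delta_theory_def by unfold_locales (blast intro: L2_axiom.intros)+

text \<open>\<open>{\<beta>. \<triangle>\<alpha> \<rightarrow> \<beta> \<in> T}\<close> is the closure of \<open>T \<union> {\<alpha>}\<close> under modus ponens and \<open>\<triangle>\<close>-necessitation.\<close>

lemma delta_theory_extend:
  assumes T: "delta_theory T"
  shows "delta_theory {\<beta>. \<^bold>\<triangle> \<alpha> \<^bold>\<rightarrow> \<beta> \<in> T}" and "T \<subseteq> {\<beta>. \<^bold>\<triangle> \<alpha> \<^bold>\<rightarrow> \<beta> \<in> T}"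
    and "\<^bold>\<triangle> \<alpha> \<^bold>\<rightarrow> \<alpha> \<in> T"
proof -
  interpret lukasiewicz_theory OImp OTilde T by (rule delta_theory_lukasiewicz[OF T])
  note ax = delta_theory_axiom[OF T]
  let ?d = "\<^bold>\<triangle> \<alpha>"
  show sub: "T \<subseteq> {\<beta>. ?d \<^bold>\<rightarrow> \<beta> \<in> T}" using le_top unfolding le_def by blast
  show "?d \<^bold>\<rightarrow> \<alpha> \<in> T" by (rule ax[OF L2_axiom.delta2])
  \<comment> \<open>Excluded middle for d, read with the defined disjunction; its contrapositive is
    d \<sqsubseteq> d \<odot> d. Thus \<triangle>\<alpha> may be used twice, which closure under
    modus ponens needs.\<close>
  have "le (OImp ?d (OTilde ?d)) (OTilde ?d)" unfolding le_def by (rule ax[OF L2_axiom.delta1])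
  then have idem: "le ?d (OTilde (OImp ?d (OTilde ?d)))" by (rule le_trans[OF le_dneg neg_anti])
  have mp': "le ?d \<gamma>" if "le ?d \<beta>" "le ?d (\<beta> \<^bold>\<rightarrow> \<gamma>)" for \<beta> \<gamma>
  proof -
    have "le ?d (?d \<^bold>\<rightarrow> \<gamma>)" by (rule le_trans[OF that(2) imp_anti[OF that(1)]])
    then have "le (OTilde (OImp ?d (OTilde ?d))) \<gamma>" by (simp only: odot_residual)
    then show ?thesis by (rule le_trans[OF idem])
  qed
  have nec': "le ?d (\<^bold>\<triangle> \<beta>)" if "le ?d \<beta>" for \<beta>
  proof -
    have "\<^bold>\<triangle> (?d \<^bold>\<rightarrow> \<beta>) \<in> T" using that delta_theory_nec[OF T] unfolding le_def by blast
    then have "le (\<^bold>\<triangle> ?d) (\<^bold>\<triangle> \<beta>)"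
      using mem_mp[of _ "\<^bold>\<triangle> ?d \<^bold>\<rightarrow> \<^bold>\<triangle> \<beta>"] ax[OF L2_axiom.delta5] unfolding le_def by blast
    moreover have "le ?d (\<^bold>\<triangle> ?d)" unfolding le_def by (rule ax[OF L2_axiom.delta3])
    ultimately show ?thesis using le_trans by blast
  qed
  show "delta_theory {\<beta>. ?d \<^bold>\<rightarrow> \<beta> \<in> T}"
    using sub ax mp' nec' unfolding delta_theory_def le_def by blast
qed

text \<open>A maximal theory without \<alpha> is linear: if both x \<rightarrow> y and y
  \<rightarrow> x were missing, \<alpha> would follow from \<triangle> of each, hence from their
  join, which is a theorem by prelinearity and \<open>delta4\<close>.\<close>

lemma linear_extension:
  assumes "delta_theory T0" "\<alpha> \<notin> T0"
  obtains T where "delta_theory T" "T0 \<subseteq> T" "\<alpha> \<notin> T" "\<And>\<beta> \<gamma>. \<beta> \<^bold>\<rightarrow> \<gamma> \<in> T \<or> \<gamma> \<^bold>\<rightarrow> \<beta> \<in> T"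
proof -
  define \<A> where "\<A> = {T. delta_theory T \<and> T0 \<subseteq> T \<and> \<alpha> \<notin> T}"
  have "T0 \<in> \<A>" using assms by (simp add: \<A>_def)
  then have "\<A> \<noteq> {}" by blast
  moreover have "\<Union>\<C> \<in> \<A>" if "\<C> \<noteq> {}" "subset.chain \<A> \<C>" for \<C>
  proof -
    have mem: "delta_theory T" "T0 \<subseteq> T" "\<alpha> \<notin> T" if "T \<in> \<C>" for T
      using that \<open>subset.chain \<A> \<C>\<close> unfolding subset_chain_def \<A>_def by auto
    obtain T where T: "T \<in> \<C>" using \<open>\<C> \<noteq> {}\<close> by blast
    have "\<beta> \<in> \<Union>\<C>" if "\<gamma> \<in> \<Union>\<C>" "\<gamma> \<^bold>\<rightarrow> \<beta> \<in> \<Union>\<C>" for \<beta> \<gamma>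
    proof -
      obtain T1 T2 where T12: "T1 \<in> \<C>" "\<gamma> \<in> T1" "T2 \<in> \<C>" "\<gamma> \<^bold>\<rightarrow> \<beta> \<in> T2"
        using \<open>\<gamma> \<in> \<Union>\<C>\<close> \<open>\<gamma> \<^bold>\<rightarrow> \<beta> \<in> \<Union>\<C>\<close> by blast
      then have "T1 \<subseteq> T2 \<or> T2 \<subseteq> T1"
        using \<open>subset.chain \<A> \<C>\<close> unfolding subset_chain_def by blast
      then show ?thesis using T12 mem(1) unfolding delta_theory_def by blast
    qed
    moreover have "\<beta> \<in> \<Union>\<C>" if "L2_axiom \<beta>" for \<beta>
      using delta_theory_axiom[OF mem(1)[OF T] that] T by blast
    moreover have "\<^bold>\<triangle> \<beta> \<in> \<Union>\<C>" if "\<beta> \<in> \<Union>\<C>" for \<beta>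
      using delta_theory_nec[OF mem(1)] that by blast
    ultimately have "delta_theory (\<Union>\<C>)" unfolding delta_theory_def by blast
    then show ?thesis using mem T unfolding \<A>_def by blast
  qed
  ultimately obtain T where "T \<in> \<A>" and max: "\<And>X. X \<in> \<A> \<Longrightarrow> T \<subseteq> X \<Longrightarrow> X = T"
    using subset_Zorn_nonempty[of \<A>] by blast
  then have T: "delta_theory T" "T0 \<subseteq> T" "\<alpha> \<notin> T" by (auto simp: \<A>_def)
  interpret lukasiewicz_theory OImp OTilde T by (rule delta_theory_lukasiewicz[OF T(1)])
  have proves: "le (\<^bold>\<triangle> \<beta>) \<alpha>" if "\<beta> \<notin> T" for \<beta>
  proof (rule ccontr)
    assume "\<not> le (\<^bold>\<triangle> \<beta>) \<alpha>"
    then have "{\<gamma>. \<^bold>\<triangle> \<beta> \<^bold>\<rightarrow> \<gamma> \<in> T} \<in> \<A>"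
      using delta_theory_extend(1,2)[OF T(1), of \<beta>] T(2) unfolding \<A>_def le_def by blast
    from max[OF this delta_theory_extend(2)[OF T(1)]] show False
      using delta_theory_extend(3)[OF T(1), of \<beta>] that by blast
  qed
  have "\<beta> \<^bold>\<rightarrow> \<gamma> \<in> T \<or> \<gamma> \<^bold>\<rightarrow> \<beta> \<in> T" for \<beta> \<gamma>
  proof (rule ccontr)
    assume "\<not> ?thesis"
    then have "le (\<^bold>\<triangle> (\<beta> \<^bold>\<rightarrow> \<gamma>)) \<alpha>" "le (\<^bold>\<triangle> (\<gamma> \<^bold>\<rightarrow> \<beta>)) \<alpha>" using proves by blast+
    then have "le (\<^bold>\<triangle> (\<beta> \<^bold>\<rightarrow> \<gamma>) \<^bold>\<or> \<^bold>\<triangle> (\<gamma> \<^bold>\<rightarrow> \<beta>)) \<alpha>" by (rule join_least)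
    moreover have "\<^bold>\<triangle> ((\<beta> \<^bold>\<rightarrow> \<gamma>) \<^bold>\<or> (\<gamma> \<^bold>\<rightarrow> \<beta>)) \<in> T"
      using delta_theory_nec[OF T(1)] prelinear unfolding le_def by blast
    moreover have "le (\<^bold>\<triangle> ((\<beta> \<^bold>\<rightarrow> \<gamma>) \<^bold>\<or> (\<gamma> \<^bold>\<rightarrow> \<beta>))) (\<^bold>\<triangle> (\<beta> \<^bold>\<rightarrow> \<gamma>) \<^bold>\<or> \<^bold>\<triangle> (\<gamma> \<^bold>\<rightarrow> \<beta>))"
      unfolding le_def by (rule delta_theory_axiom[OF T(1) L2_axiom.delta4])
    ultimately have "\<alpha> \<in> T" using mem_mp by blast
    then show False using T(3) by simp
  qed
  then show thesis using that T by blast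
qed

section \<open>Completeness\<close>

fun subformulas :: "'p outer \<Rightarrow> 'p outer set" where
  "subformulas (Pr \<phi>) = {Pr \<phi>}"
| "subformulas (\<^bold>\<not> \<alpha>) = insert (\<^bold>\<not> \<alpha>) (subformulas \<alpha>)"
| "subformulas (\<alpha> \<^bold>\<rightarrow> \<beta>) = insert (\<alpha> \<^bold>\<rightarrow> \<beta>) (subformulas \<alpha> \<union> subformulas \<beta>)"
| "subformulas (\<^bold>\<sim> \<alpha>) = insert (\<^bold>\<sim> \<alpha>) (subformulas \<alpha>)"
| "subformulas (\<^bold>\<triangle> \<alpha>) = insert (\<^bold>\<triangle> \<alpha>) (subformulas \<alpha>)"

lemma finite_subformulas: "finite (subformulas \<alpha>)"
  by (induction \<alpha>) auto

lemma subformulas_refl: "\<alpha> \<in> subformulas \<alpha>"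
  by (cases \<alpha>) auto

lemma subformulas_trans: "\<beta> \<in> subformulas \<alpha> \<Longrightarrow> subformulas \<beta> \<subseteq> subformulas \<alpha>"
  by (induction \<alpha>) auto

abbreviation conflate :: "'p outer \<Rightarrow> 'p outer" where
  "conflate \<alpha> \<equiv> \<^bold>\<sim> \<^bold>\<not> \<alpha>"

abbreviation incl_excl_formula :: "'p bd \<Rightarrow> 'p bd \<Rightarrow> 'p outer" where
  "incl_excl_formula \<phi> \<psi> \<equiv> Pr (BOr \<phi> \<psi>) \<^bold>\<leftrightarrow> ((Pr \<phi> \<^bold>\<ominus> Pr (BAnd \<phi> \<psi>)) \<^bold>\<oplus> Pr \<psi>)"

text \<open>\<open>Pr (BNeg \<phi>)\<close> is added because the modal negation axiom makes its
  value the second component of \<open>Pr \<phi>\<close>.\<close>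

definition conflation_closure :: "'p outer set \<Rightarrow> 'p outer set" where
  "conflation_closure F = F \<union> conflate ` F \<union> (\<lambda>\<phi>. Pr (BNeg \<phi>)) ` (Pr -` F)"

text \<open>The extra layer of connectives is there because the embedding respects a connective only
  where arguments and result are both in its domain, and the De Morgan axioms turn the conflation of
  a compound into a compound of conflations.\<close>

definition embedding_domain :: "'p outer set \<Rightarrow> 'p outer set" where
  "embedding_domain F = (let G = conflation_closure F in
     G \<union> (\<lambda>(\<alpha>, \<beta>). \<alpha> \<^bold>\<rightarrow> \<beta>) ` (G \<times> G) \<union> OTilde ` G \<union> ODelta ` G \<union> (\<lambda>\<alpha>. \<^bold>\<sim> \<^bold>\<triangle> \<alpha>) ` G)"

lemma finite_embedding_domain: "finite F \<Longrightarrow> finite (embedding_domain F)"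
  unfolding embedding_domain_def conflation_closure_def Let_def
  by (intro finite_UnI finite_imageI finite_cartesian_product finite_vimageI) (auto simp: inj_on_def)

text \<open>Conflation swaps the components \<open>a\<^sub>1\<close> and \<open>1 - a\<^sub>2\<close> of a value, so the second component of a
  formula can be read off the embedded image of its conflation.\<close>

locale outer_embedding =
  fixes T F :: "'p outer set" and x :: "'p outer \<Rightarrow> real"
  assumes T: "delta_theory T"
    and T_modal: "modal_axiom \<beta> \<Longrightarrow> \<beta> \<in> T"
    and T_linear: "\<beta> \<^bold>\<rightarrow> \<gamma> \<in> T \<or> \<gamma> \<^bold>\<rightarrow> \<beta> \<in> T"
    and F_closed: "\<beta> \<in> F \<Longrightarrow> subformulas \<beta> \<subseteq> F"
    and x_bounds: "\<beta> \<in> embedding_domain F \<Longrightarrow> 0 \<le> x \<beta> \<and> x \<beta> \<le> 1"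
    and x_le: "\<beta> \<in> embedding_domain F \<Longrightarrow> \<gamma> \<in> embedding_domain F \<Longrightarrow> x \<beta> \<le> x \<gamma> \<longleftrightarrow> \<beta> \<^bold>\<rightarrow> \<gamma> \<in> T"
    and x_top: "\<beta> \<in> embedding_domain F \<Longrightarrow> x \<beta> = 1 \<longleftrightarrow> \<beta> \<in> T"
    and x_imp: "\<beta> \<in> embedding_domain F \<Longrightarrow> \<gamma> \<in> embedding_domain F \<Longrightarrow>
      \<beta> \<^bold>\<rightarrow> \<gamma> \<in> embedding_domain F \<Longrightarrow> x (\<beta> \<^bold>\<rightarrow> \<gamma>) = min 1 (1 - x \<beta> + x \<gamma>)"
    and x_tilde: "\<beta> \<in> embedding_domain F \<Longrightarrow> \<^bold>\<sim> \<beta> \<in> embedding_domain F \<Longrightarrow> x (\<^bold>\<sim> \<beta>) = 1 - x \<beta>"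
begin

sublocale lukasiewicz_theory OImp OTilde T
  by (rule delta_theory_lukasiewicz[OF T])

lemma domainI:
  "\<beta> \<in> F \<Longrightarrow> \<beta> \<in> embedding_domain F"
  "\<beta> \<in> F \<Longrightarrow> conflate \<beta> \<in> embedding_domain F"
  "\<beta> \<in> F \<Longrightarrow> \<^bold>\<sim> \<beta> \<in> embedding_domain F"
  "\<beta> \<in> F \<Longrightarrow> \<^bold>\<sim> (conflate \<beta>) \<in> embedding_domain F"
  "\<beta> \<in> F \<Longrightarrow> \<gamma> \<in> F \<Longrightarrow> conflate \<beta> \<^bold>\<rightarrow> conflate \<gamma> \<in> embedding_domain F"
  "\<beta> \<in> F \<Longrightarrow> \<^bold>\<triangle> (conflate \<beta>) \<in> embedding_domain F"
  "\<beta> \<in> F \<Longrightarrow> \<^bold>\<sim> \<^bold>\<triangle> \<beta> \<in> embedding_domain F"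
  "\<beta> \<in> F \<Longrightarrow> \<^bold>\<sim> \<^bold>\<triangle> (conflate \<beta>) \<in> embedding_domain F"
  "Pr \<phi> \<in> F \<Longrightarrow> Pr (BNeg \<phi>) \<in> embedding_domain F"
  "Pr \<phi> \<in> F \<Longrightarrow> \<^bold>\<sim> Pr (BNeg \<phi>) \<in> embedding_domain F"
  unfolding embedding_domain_def conflation_closure_def Let_def by auto

lemma F_simps:
  "\<^bold>\<not> \<beta> \<in> F \<Longrightarrow> \<beta> \<in> F" "\<^bold>\<sim> \<beta> \<in> F \<Longrightarrow> \<beta> \<in> F" "\<^bold>\<triangle> \<beta> \<in> F \<Longrightarrow> \<beta> \<in> F"
  "\<beta> \<^bold>\<rightarrow> \<gamma> \<in> F \<Longrightarrow> \<beta> \<in> F" "\<beta> \<^bold>\<rightarrow> \<gamma> \<in> F \<Longrightarrow> \<gamma> \<in> F"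
  using F_closed subformulas_refl by fastforce+

definition val :: "'p outer \<Rightarrow> real \<times> real" where
  "val \<beta> = (x \<beta>, 1 - x (conflate \<beta>))"

lemma iffD:
  assumes "\<beta> \<^bold>\<leftrightarrow> \<gamma> \<in> T" shows "le \<beta> \<gamma>" "le \<gamma> \<beta>"
  using mem_mp[OF assms odot_le1] mem_mp[OF assms odot_le2] unfolding le_def .

lemma axiom_iffD:
  assumes "L2_axiom (\<beta> \<^bold>\<leftrightarrow> \<gamma>)" shows "le \<beta> \<gamma>" "le \<gamma> \<beta>"
  using iffD[OF delta_theory_axiom[OF T assms]] .

lemma x_eq:
  "\<beta> \<in> embedding_domain F \<Longrightarrow> \<gamma> \<in> embedding_domain F \<Longrightarrow> le \<beta> \<gamma> \<Longrightarrow> le \<gamma> \<beta> \<Longrightarrow> x \<beta> = x \<gamma>"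
  using x_le[of \<beta> \<gamma>] x_le[of \<gamma> \<beta>] unfolding le_def by simp

text \<open>The embedding is not told about \<triangle>. On a chain, excluded middle for
  \<triangle>\<beta> leaves only top and bottom, and \<open>delta2\<close> excludes top when \<beta>
  is not in \<open>T\<close>.\<close>

lemma x_delta:
  assumes "\<beta> \<in> embedding_domain F" "\<^bold>\<triangle> \<beta> \<in> embedding_domain F" "\<^bold>\<sim> \<^bold>\<triangle> \<beta> \<in> embedding_domain F"
  shows "x (\<^bold>\<triangle> \<beta>) = delta_L (x \<beta>)"
proof (cases "\<beta> \<in> T")
  case True
  then show ?thesis
    using delta_theory_nec[OF T] x_top[OF assms(1)] x_top[OF assms(2)] by (simp add: delta_L_def)
next
  case False
  have d: "\<^bold>\<triangle> \<beta> \<notin> T"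
    using False mem_mp delta_theory_axiom[OF T L2_axiom.delta2] unfolding le_def by blast
  have em: "le (OImp (\<^bold>\<triangle> \<beta>) (OTilde (\<^bold>\<triangle> \<beta>))) (OTilde (\<^bold>\<triangle> \<beta>))"
    unfolding le_def by (rule delta_theory_axiom[OF T L2_axiom.delta1])
  then have em': "le (OImp (OTilde (\<^bold>\<triangle> \<beta>)) (\<^bold>\<triangle> \<beta>)) (\<^bold>\<triangle> \<beta>)" by (rule le_mp[OF _ ax_waj])
  have "\<^bold>\<sim> \<^bold>\<triangle> \<beta> \<in> T"
    using T_linear[of "\<^bold>\<triangle> \<beta>" "\<^bold>\<sim> \<^bold>\<triangle> \<beta>"] mem_mp[OF _ em] mem_mp[OF _ em'] d by blast
  then have "x (\<^bold>\<triangle> \<beta>) = 0" using x_top[OF assms(3)] x_tilde[OF assms(2,3)] by simp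
  then show ?thesis using False x_top[OF assms(1)] by (simp add: delta_L_def)
qed

lemma val_imp:
  assumes "\<beta> \<^bold>\<rightarrow> \<gamma> \<in> F" shows "val (\<beta> \<^bold>\<rightarrow> \<gamma>) = L2_imp (val \<beta>) (val \<gamma>)"
proof -
  have F: "\<beta> \<in> F" "\<gamma> \<in> F" using F_simps assms by blast+
  have "x (conflate (\<beta> \<^bold>\<rightarrow> \<gamma>)) = x (conflate \<beta> \<^bold>\<rightarrow> conflate \<gamma>)"
    using axiom_iffD[OF L2_axiom.deM_imp[of \<beta> \<gamma>]] by (intro x_eq domainI F assms)
  also have "\<dots> = min 1 (1 - x (conflate \<beta>) + x (conflate \<gamma>))" by (intro x_imp domainI F)
  finally have c: "x (conflate (\<beta> \<^bold>\<rightarrow> \<gamma>)) = min 1 (1 - x (conflate \<beta>) + x (conflate \<gamma>))" .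
  have "x (\<beta> \<^bold>\<rightarrow> \<gamma>) = min 1 (1 - x \<beta> + x \<gamma>)" by (intro x_imp domainI F assms)
  then show ?thesis unfolding val_def c by (auto simp: min_def max_def)
qed

lemma val_tilde:
  assumes "\<^bold>\<sim> \<beta> \<in> F" shows "val (\<^bold>\<sim> \<beta>) = L2_tilde (val \<beta>)"
proof -
  have F: "\<beta> \<in> F" using F_simps assms by blast
  have "x (conflate (\<^bold>\<sim> \<beta>)) = x (\<^bold>\<sim> (conflate \<beta>))"
    using axiom_iffD[OF L2_axiom.deM_tilde[of \<beta>]] by (intro x_eq domainI F assms neg_anti)
  also have "\<dots> = 1 - x (conflate \<beta>)" by (intro x_tilde domainI F)
  finally have c: "x (conflate (\<^bold>\<sim> \<beta>)) = 1 - x (conflate \<beta>)" .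
  have "x (\<^bold>\<sim> \<beta>) = 1 - x \<beta>" by (intro x_tilde domainI F)
  then show ?thesis unfolding val_def c by simp
qed

lemma val_delta:
  assumes "\<^bold>\<triangle> \<beta> \<in> F" shows "val (\<^bold>\<triangle> \<beta>) = L2_delta (val \<beta>)"
proof -
  have F: "\<beta> \<in> F" using F_simps assms by blast
  note ax = axiom_iffD[OF L2_axiom.deM_delta[of \<beta>]]
  have "x (conflate (\<^bold>\<triangle> \<beta>)) = x (\<^bold>\<triangle> (conflate \<beta>))"
    by (intro x_eq domainI F assms le_trans[OF neg_anti[OF ax(2)] dneg_le] le_trans[OF le_dneg neg_anti[OF ax(1)]])
  also have "\<dots> = delta_L (x (conflate \<beta>))" by (intro x_delta domainI F)
  finally have c: "x (conflate (\<^bold>\<triangle> \<beta>)) = delta_L (x (conflate \<beta>))" .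
  have "x (\<^bold>\<triangle> \<beta>) = delta_L (x \<beta>)" by (intro x_delta domainI F assms)
  then show ?thesis unfolding val_def c by simp
qed

lemma val_neg:
  assumes "\<^bold>\<not> \<beta> \<in> F" shows "val (\<^bold>\<not> \<beta>) = L2_neg (val \<beta>)"
proof -
  have F: "\<beta> \<in> F" using F_simps assms by blast
  have "x (conflate (\<^bold>\<not> \<beta>)) = x (\<^bold>\<sim> \<beta>)"
    using axiom_iffD[OF L2_axiom.neg[of \<beta>]] by (intro x_eq domainI F assms neg_anti)
  also have "\<dots> = 1 - x \<beta>" by (intro x_tilde domainI F)
  finally have c: "x (conflate (\<^bold>\<not> \<beta>)) = 1 - x \<beta>" .
  have "x (\<^bold>\<not> \<beta>) = x (\<^bold>\<sim> (conflate \<beta>))" by (intro x_eq domainI F assms le_dneg dneg_le)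
  also have "\<dots> = 1 - x (conflate \<beta>)" by (intro x_tilde domainI F)
  finally show ?thesis unfolding val_def c by simp
qed

lemma val_Pr:
  assumes "Pr \<phi> \<in> F" shows "val (Pr \<phi>) = (x (Pr \<phi>), x (Pr (BNeg \<phi>)))"
proof -
  have "x (conflate (Pr \<phi>)) = x (\<^bold>\<sim> Pr (BNeg \<phi>))"
    using iffD[OF T_modal[OF modal_axiom.neg[of \<phi>]]] by (intro x_eq domainI assms neg_anti)
  also have "\<dots> = 1 - x (Pr (BNeg \<phi>))" by (intro x_tilde domainI assms)
  finally show ?thesis unfolding val_def by simp
qed

lemma val_closed: "\<beta> \<in> F \<Longrightarrow> val \<beta> \<in> unit_square"
  using x_bounds[OF domainI(1)] x_bounds[OF domainI(2)] by (auto simp: val_def unit_square_def)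

lemma val_designated: "\<beta> \<in> F \<Longrightarrow> \<beta> \<in> T \<Longrightarrow> conflate \<beta> \<in> T \<Longrightarrow> val \<beta> = (1, 0)"
  using x_top[OF domainI(1)] x_top[OF domainI(2)] by (simp add: val_def)

lemma val_not_designated: "\<beta> \<in> F \<Longrightarrow> \<beta> \<notin> T \<Longrightarrow> val \<beta> \<noteq> (1, 0)"
  using x_top[OF domainI(1)] by (simp add: val_def)

lemma x_Pr_cong:
  "Pr \<phi> \<in> embedding_domain F \<Longrightarrow> Pr \<psi> \<in> embedding_domain F \<Longrightarrow> \<phi> \<turnstile>\<^sub>B\<^sub>D \<psi> \<Longrightarrow> \<psi> \<turnstile>\<^sub>B\<^sub>D \<phi> \<Longrightarrow>
    x (Pr \<phi>) = x (Pr \<psi>)"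
  using T_modal[OF modal_axiom.mono] by (intro x_eq) (auto simp: le_def)

lemma x_Pr_mono:
  "Pr \<phi> \<in> embedding_domain F \<Longrightarrow> Pr \<psi> \<in> embedding_domain F \<Longrightarrow> \<phi> \<turnstile>\<^sub>B\<^sub>D \<psi> \<Longrightarrow> x (Pr \<phi>) \<le> x (Pr \<psi>)"
  using T_modal[OF modal_axiom.mono] x_le by blast

lemma val_iff:
  assumes "\<beta> \<^bold>\<leftrightarrow> \<gamma> \<in> F" "val (\<beta> \<^bold>\<leftrightarrow> \<gamma>) = (1, 0)"
  shows "val \<beta> = val \<gamma>"
proof -
  note F = assms(1) F_simps(2)[OF assms(1)]
  have F': "\<beta> \<^bold>\<rightarrow> \<gamma> \<in> F" "\<^bold>\<sim> (\<gamma> \<^bold>\<rightarrow> \<beta>) \<in> F" "\<gamma> \<^bold>\<rightarrow> \<beta> \<in> F" "\<beta> \<in> F" "\<gamma> \<in> F"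
    using F F_simps by blast+
  show ?thesis
    using assms(2) L2_iff_designated[OF val_closed[OF F'(4)] val_closed[OF F'(5)]]
    by (simp add: val_tilde[OF F(1)] val_imp[OF F(2)] val_imp[OF F'(1)] val_tilde[OF F'(2)] val_imp[OF F'(3)])
qed

text \<open>The axiom in \<open>T\<close> fixes only the first component of its value; its
  conflation fixes the second, so that the axiom becomes an equation between pairs.\<close>

lemma incl_excl_val:
  assumes F: "incl_excl_formula \<phi> \<psi> \<in> F" and c: "conflate (incl_excl_formula \<phi> \<psi>) \<in> T"
  shows "Pr \<phi> \<in> F" "Pr \<psi> \<in> F" "Pr (BOr \<phi> \<psi>) \<in> F" "Pr (BAnd \<phi> \<psi>) \<in> F"
    and "val (Pr (BOr \<phi> \<psi>)) =
      L2_imp (L2_tilde (L2_tilde (L2_imp (val (Pr \<phi>)) (val (Pr (BAnd \<phi> \<psi>)))))) (val (Pr \<psi>))"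
proof -
  have F': "Pr (BOr \<phi> \<psi>) \<^bold>\<rightarrow> (Pr \<phi> \<^bold>\<ominus> Pr (BAnd \<phi> \<psi>)) \<^bold>\<oplus> Pr \<psi> \<in> F" using F F_simps by blast
  then have 1: "Pr (BOr \<phi> \<psi>) \<in> F" "(Pr \<phi> \<^bold>\<ominus> Pr (BAnd \<phi> \<psi>)) \<^bold>\<oplus> Pr \<psi> \<in> F" using F_simps by blast+
  then have 2: "\<^bold>\<sim> (Pr \<phi> \<^bold>\<ominus> Pr (BAnd \<phi> \<psi>)) \<in> F" "Pr \<psi> \<in> F" using F_simps by blast+
  then have 3: "Pr \<phi> \<^bold>\<ominus> Pr (BAnd \<phi> \<psi>) \<in> F" using F_simps by blast
  then have 4: "Pr \<phi> \<^bold>\<rightarrow> Pr (BAnd \<phi> \<psi>) \<in> F" using F_simps by blast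
  then show "Pr \<phi> \<in> F" "Pr \<psi> \<in> F" "Pr (BOr \<phi> \<psi>) \<in> F" "Pr (BAnd \<phi> \<psi>) \<in> F"
    using F_simps 1 2 by blast+
  have "val (incl_excl_formula \<phi> \<psi>) = (1, 0)"
    by (rule val_designated[OF F T_modal[OF modal_axiom.incl_excl] c])
  from val_iff[OF F this]
  show "val (Pr (BOr \<phi> \<psi>)) =
      L2_imp (L2_tilde (L2_tilde (L2_imp (val (Pr \<phi>)) (val (Pr (BAnd \<phi> \<psi>)))))) (val (Pr \<psi>))"
    unfolding val_imp[OF 1(2)] val_tilde[OF 2(1)] val_tilde[OF 3] val_imp[OF 4] .
qed

text \<open>The axiom alone only gives \<open>Pr(\<phi> \<or> \<psi>)\<close> truncated at 1. The second component of its instance at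
  the negated formulas gives \<open>Pr(\<phi> \<and> \<psi>)\<close> truncated at 0, and the two together exclude truncation.\<close>

lemma x_modular:
  assumes "incl_excl_formula \<phi> \<psi> \<in> F" "conflate (incl_excl_formula \<phi> \<psi>) \<in> T"
    and "incl_excl_formula (BNeg \<phi>) (BNeg \<psi>) \<in> F" "conflate (incl_excl_formula (BNeg \<phi>) (BNeg \<psi>)) \<in> T"
  shows "x (Pr (BOr \<phi> \<psi>)) + x (Pr (BAnd \<phi> \<psi>)) = x (Pr \<phi>) + x (Pr \<psi>)"
proof -
  note 1 = incl_excl_val[OF assms(1,2)] and 2 = incl_excl_val[OF assms(3,4)]
  have "x (Pr (BNeg (BOr (BNeg \<phi>) (BNeg \<psi>)))) = x (Pr (BAnd \<phi> \<psi>))"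
  proof (rule x_Pr_cong[OF domainI(9)[OF 2(3)] domainI(1)[OF 1(4)]])
    have "BNeg (BOr (BNeg \<phi>) (BNeg \<psi>)) \<turnstile>\<^sub>B\<^sub>D BNeg (BNeg \<phi>)"
      "BNeg (BOr (BNeg \<phi>) (BNeg \<psi>)) \<turnstile>\<^sub>B\<^sub>D BNeg (BNeg \<psi>)"
      by (rule bd_derives.contrapos, rule bd_derives.disjI1 bd_derives.disjI2)+
    then show "BNeg (BOr (BNeg \<phi>) (BNeg \<psi>)) \<turnstile>\<^sub>B\<^sub>D BAnd \<phi> \<psi>"
      by (intro bd_derives.conjI) (erule bd_derives.cut, rule bd_derives.dnegE)+
    show "BAnd \<phi> \<psi> \<turnstile>\<^sub>B\<^sub>D BNeg (BOr (BNeg \<phi>) (BNeg \<psi>))"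
      by (rule bd_derives.cut[OF bd_conj_mono[OF bd_derives.dnegI bd_derives.dnegI] bd_derives.deMorgan_disj])
  qed
  moreover have "x (Pr (BNeg (BAnd (BNeg \<phi>) (BNeg \<psi>)))) = x (Pr (BOr \<phi> \<psi>))"
  proof (rule x_Pr_cong[OF domainI(9)[OF 2(4)] domainI(1)[OF 1(3)]])
    show "BNeg (BAnd (BNeg \<phi>) (BNeg \<psi>)) \<turnstile>\<^sub>B\<^sub>D BOr \<phi> \<psi>"
      by (rule bd_derives.cut[OF bd_derives.deMorgan_conj bd_disj_mono[OF bd_derives.dnegE bd_derives.dnegE]])
    have "BNeg (BNeg \<phi>) \<turnstile>\<^sub>B\<^sub>D BNeg (BAnd (BNeg \<phi>) (BNeg \<psi>))"
      "BNeg (BNeg \<psi>) \<turnstile>\<^sub>B\<^sub>D BNeg (BAnd (BNeg \<phi>) (BNeg \<psi>))"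
      by (rule bd_derives.contrapos, rule bd_derives.conjE1 bd_derives.conjE2)+
    from bd_derives.disjE[OF bd_derives.cut[OF bd_derives.dnegI this(1)] bd_derives.cut[OF bd_derives.dnegI this(2)]]
    show "BOr \<phi> \<psi> \<turnstile>\<^sub>B\<^sub>D BNeg (BAnd (BNeg \<phi>) (BNeg \<psi>))" .
  qed
  moreover have "x (Pr (BNeg (BNeg \<phi>))) = x (Pr \<phi>)" "x (Pr (BNeg (BNeg \<psi>))) = x (Pr \<psi>)"
    by (rule x_Pr_cong[OF domainI(9) domainI(1) bd_derives.dnegE bd_derives.dnegI], rule 1 2, rule 1 2)+
  moreover have "x (Pr (BAnd \<phi> \<psi>)) \<le> x (Pr \<phi>)" "x (Pr \<phi>) \<le> x (Pr (BOr \<phi> \<psi>))"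
    by (intro x_Pr_mono domainI(1) 1(1,3,4) bd_derives.conjE1 bd_derives.disjI1)+
  moreover have "0 \<le> x (Pr (BAnd \<phi> \<psi>))" "x (Pr (BOr \<phi> \<psi>)) \<le> 1"
    using x_bounds[OF domainI(1)[OF 1(4)]] x_bounds[OF domainI(1)[OF 1(3)]] by auto
  \<comment> \<open>If the disjunction is truncated at 1 and the conjunction at 0, the values of
    \<phi> and \<psi> add up to at least 1 and to at most 1, so even then the equation is
    exact.\<close>
  ultimately show ?thesis
    using 1(5) 2(5) unfolding val_Pr[OF 1(1)] val_Pr[OF 1(2)] val_Pr[OF 1(3)] val_Pr[OF 1(4)]
      val_Pr[OF 2(1)] val_Pr[OF 2(2)] val_Pr[OF 2(3)] val_Pr[OF 2(4)]
    by (auto simp: min_def max_def split: if_splits)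
qed

end

section \<open>Construction of the countermodel\<close>

lemma delta_theory_derivable: "delta_theory {\<beta>. pr_derives \<Gamma> \<beta>}"
  unfolding delta_theory_def using pr_derives.L2 pr_derives.mp pr_derives.nec by blast

lemma countermodel:
  fixes \<Gamma> :: "'p outer set"
  assumes "finite \<Gamma>" "\<not> pr_derives \<Gamma> \<alpha>"
  obtains W :: "'w::infinite set" and vp vm P where "prob_bd_model W vp vm P"
    "\<And>\<gamma>. \<gamma> \<in> \<Gamma> \<Longrightarrow> outer_val vp vm P \<gamma> = (1, 0)" "outer_val vp vm P \<alpha> \<noteq> (1, 0)"
proof -
  define D where "D = {\<beta>. pr_derives \<Gamma> \<beta>}"
  have "delta_theory D" "\<alpha> \<notin> D" using delta_theory_derivable assms(2) by (auto simp: D_def)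
  then obtain T where T: "delta_theory T" "D \<subseteq> T" "\<alpha> \<notin> T"
    and linear: "\<And>\<beta> \<gamma>. \<beta> \<^bold>\<rightarrow> \<gamma> \<in> T \<or> \<gamma> \<^bold>\<rightarrow> \<beta> \<in> T"
    using linear_extension by blast
  interpret lukasiewicz_theory OImp OTilde T by (rule delta_theory_lukasiewicz[OF T(1)])
  interpret lukasiewicz_chain OImp OTilde T by unfold_locales (simp add: le_def linear)
  have modal: "\<beta> \<in> T" "conflate \<beta> \<in> T" if "modal_axiom \<beta>" for \<beta>
    using that T(2) pr_derives.modal pr_derives.conf unfolding D_def by blast+
  define V where "V = \<Union> (set_outer ` insert \<alpha> \<Gamma>)"
  define L where "L = V \<times> (UNIV :: bool set)"
  \<comment> \<open>One representative for each of the finitely many upsets, so finitely many modal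
    instances suffice.\<close>
  define R where "R = normal_form ` Collect (upset L)"
  \<comment> \<open>The instances at negated formulas are the ones with which
    \<open>x_modular\<close> excludes truncation.\<close>
  define F0 where "F0 = insert \<alpha> \<Gamma> \<union> (\<lambda>(\<phi>, \<psi>). incl_excl_formula \<phi> \<psi>) ` (R \<times> R) \<union>
    (\<lambda>(\<phi>, \<psi>). incl_excl_formula (BNeg \<phi>) (BNeg \<psi>)) ` (R \<times> R)"
  define F where "F = \<Union> (subformulas ` F0)"
  have F0: "\<beta> \<in> F" if "\<beta> \<in> F0" for \<beta>
    using that subformulas_refl[of \<beta>] by (auto simp: F_def)
  have fin_set: "finite (set_outer \<beta>)" for \<beta> :: "'p outer"
  proof (induction \<beta>)
    case (Pr \<phi>)
    then show ?case by (induction \<phi>) auto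
  qed auto
  have finV: "finite V" using assms(1) fin_set by (simp add: V_def)
  then have finL: "finite L" by (simp add: L_def)
  have "set_outer \<alpha> \<noteq> {}" by (induction \<alpha>) (auto simp: set_bd_ne)
  then have neL: "L \<noteq> {}" by (auto simp: L_def V_def)
  have "Collect (upset L) \<subseteq> Pow (Pow L)" using upset_subset by blast
  then have "finite R" unfolding R_def using finL by (auto intro: finite_subset)
  then have finF: "finite F" unfolding F_def F0_def using assms(1) by (simp add: finite_subformulas)
  \<comment> \<open>A concrete top element. Its negation is not in \<open>T\<close>, as it lies
    below \<alpha>; so the chain is nontrivial.\<close>
  let ?t = "\<alpha> \<^bold>\<rightarrow> \<alpha>"
  have t: "?t \<in> T" using le_refl unfolding le_def .
  then have t': "\<^bold>\<sim> ?t \<notin> T" using mem_mp[OF _ neg_top_le[OF t]] T(3) by blast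
  obtain x :: "'p outer \<Rightarrow> real" where x: "\<And>a. a \<in> embedding_domain F \<Longrightarrow> 0 \<le> x a \<and> x a \<le> 1"
    "\<And>a b. a \<in> embedding_domain F \<Longrightarrow> b \<in> embedding_domain F \<Longrightarrow> x a \<le> x b \<longleftrightarrow> le a b"
    "\<And>a. a \<in> embedding_domain F \<Longrightarrow> x a = 1 \<longleftrightarrow> a \<in> T"
    "\<And>a b. a \<in> embedding_domain F \<Longrightarrow> b \<in> embedding_domain F \<Longrightarrow> a \<^bold>\<rightarrow> b \<in> embedding_domain F \<Longrightarrow>
      x (a \<^bold>\<rightarrow> b) = min 1 (1 - x a + x b)"
    "\<And>a. a \<in> embedding_domain F \<Longrightarrow> \<^bold>\<sim> a \<in> embedding_domain F \<Longrightarrow> x (\<^bold>\<sim> a) = 1 - x a"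
    by (rule finite_partial_embedding[OF finite_embedding_domain[OF finF] t t']) (rule that)
  interpret emb: outer_embedding T F x
  proof
    show "subformulas \<beta> \<subseteq> F" if "\<beta> \<in> F" for \<beta>
      using that subformulas_trans unfolding F_def by blast
  qed (use T(1) modal linear x in \<open>auto simp: le_def\<close>)
  have in_R: "normal_form U \<in> R" if "upset L U" for U using that by (auto simp: R_def)
  have instances: "incl_excl_formula \<phi> \<psi> \<in> F" "incl_excl_formula (BNeg \<phi>) (BNeg \<psi>) \<in> F"
    if "\<phi> \<in> R" "\<psi> \<in> R" for \<phi> \<psi>
  proof -
    have "incl_excl_formula \<phi> \<psi> \<in> (\<lambda>(\<phi>, \<psi>). incl_excl_formula \<phi> \<psi>) ` (R \<times> R)"
      "incl_excl_formula (BNeg \<phi>) (BNeg \<psi>) \<in>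
        (\<lambda>(\<phi>, \<psi>). incl_excl_formula (BNeg \<phi>) (BNeg \<psi>)) ` (R \<times> R)"
      using that by (intro image_eqI[of _ _ "(\<phi>, \<psi>)"]; simp)+
    then show "incl_excl_formula \<phi> \<psi> \<in> F" "incl_excl_formula (BNeg \<phi>) (BNeg \<psi>) \<in> F"
      by (intro F0; simp add: F0_def)+
  qed
  note instances_T = modal(2)[OF modal_axiom.incl_excl]
  define g where "g U = x (Pr (normal_form U))" for U
  \<comment> \<open>\<open>Pr (normal_form U)\<close> occurs as a subformula in the instance with
    both formulas equal.\<close>
  have dom: "Pr (normal_form U) \<in> F" if "upset L U" for U
    by (rule emb.incl_excl_val(1)[OF instances(1)[OF in_R[OF that] in_R[OF that]] instances_T])
  note dom' = emb.domainI(1)[OF dom]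
  have g_mono: "g U \<le> g U'" if "upset L U" "upset L U'" "U \<subseteq> U'" for U U'
    unfolding g_def using that normal_form_mono[OF finV] by (intro emb.x_Pr_mono dom') (auto simp: L_def)
  have g_modular: "g (U \<union> U') + g (U \<inter> U') = g U + g U'" if U: "upset L U" "upset L U'" for U U'
  proof -
    note R = in_R[OF U(1)] in_R[OF U(2)]
    note U' = U[unfolded L_def]
    note F = emb.incl_excl_val(3,4)[OF instances(1)[OF R] instances_T]
    have "g (U \<union> U') = x (Pr (BOr (normal_form U) (normal_form U')))" unfolding g_def
      by (intro emb.x_Pr_cong dom' upset_union U emb.domainI(1)[OF F(1)] normal_form_union[OF finV] U')
    moreover have "g (U \<inter> U') = x (Pr (BAnd (normal_form U) (normal_form U')))" unfolding g_def
      by (intro emb.x_Pr_cong dom' upset_inter U emb.domainI(1)[OF F(2)] normal_form_inter[OF finV] U')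
    ultimately show ?thesis
      using emb.x_modular[OF instances(1)[OF R] instances_T instances(2)[OF R] instances_T] by (simp add: g_def)
  qed
  have g_bounds: "0 \<le> g U \<and> g U \<le> 1" if "upset L U" for U
    unfolding g_def by (rule x(1)[OF dom'[OF that]])
  obtain p where p: "\<And>S. S \<in> Pow L \<Longrightarrow> 0 \<le> p S" "(\<Sum>S\<in>Pow L. p S) = 1"
    "\<And>U. upset L U \<Longrightarrow> g U = (\<Sum>S\<in>U. p S)"
    by (rule modular_is_additive[OF finL neL g_mono g_modular g_bounds]) (assumption | rule that)+
  obtain vp vm and P :: "'w measure" where model: "prob_bd_model UNIV vp vm P"
    and meas: "\<And>\<phi>. measure P (supp_pos vp vm \<phi>) = (\<Sum>S\<in>canon_pos \<phi> \<inter> Pow L. p S)"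
    "\<And>\<phi>. measure P (supp_neg vp vm \<phi>) = (\<Sum>S\<in>canon_neg \<phi> \<inter> Pow L. p S)"
    using realize_in_model[OF finL p(1,2)] by blast
  have supp: "measure P (supp_pos vp vm \<phi>) = x (Pr \<phi>)"
    if "set_bd \<phi> \<subseteq> V" "Pr \<phi> \<in> embedding_domain F" for \<phi>
  proof -
    note up = upset_canon(1)[OF that(1), folded L_def]
    \<comment> \<open>The empty state, which carries the leftover mass, supports no formula.\<close>
    have "canon_pos \<phi> \<inter> Pow L = canon_pos \<phi> \<inter> states V"
      using canon_empty by (auto simp: states_def L_def)
    then have "measure P (supp_pos vp vm \<phi>) = g (canon_pos \<phi> \<inter> states V)"
      using meas(1) p(3)[OF up] by simp
    also have "\<dots> = x (Pr \<phi>)" unfolding g_def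
      using canon_normal_form[OF finV that(1)] normal_form_canon[OF finV that(1)]
      by (intro emb.x_Pr_cong dom' up that(2)) auto
    finally show ?thesis .
  qed
  \<comment> \<open>\<open>F\<close> also contains the added axiom instances. Their normal forms are
    picked by choice and have no controlled variables, hence the restriction to
    \<open>V\<close>.\<close>
  have val: "outer_val vp vm P \<beta> = emb.val \<beta>" if "\<beta> \<in> F" "set_outer \<beta> \<subseteq> V" for \<beta>
    using that
  proof (induction \<beta>)
    case (Pr \<phi>)
    then have "measure P (supp_pos vp vm (BNeg \<phi>)) = x (Pr (BNeg \<phi>))"
      by (intro supp emb.domainI(9)) auto
    moreover have "measure P (supp_pos vp vm \<phi>) = x (Pr \<phi>)"
      using Pr by (intro supp emb.domainI(1)) auto
    ultimately show ?case using emb.val_Pr[OF Pr(1)] by simp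
  next
    case (ONeg \<beta>)
    then show ?case using emb.F_simps(1) emb.val_neg by simp
  next
    case (OImp \<beta> \<gamma>)
    then show ?case using emb.F_simps(4,5)[OF OImp.prems(1)] emb.val_imp by simp
  next
    case (OTilde \<beta>)
    then show ?case using emb.F_simps(2) emb.val_tilde by simp
  next
    case (ODelta \<beta>)
    then show ?case using emb.F_simps(3) emb.val_delta by simp
  qed
  have in_F: "\<beta> \<in> F \<and> set_outer \<beta> \<subseteq> V" if "\<beta> \<in> insert \<alpha> \<Gamma>" for \<beta>
    using that F0[of \<beta>] by (auto simp: F0_def V_def)
  show thesis
  proof (rule that[OF model])
    fix \<gamma> assume "\<gamma> \<in> \<Gamma>"
    \<comment> \<open>The conflation rule, applied to a premise before extending, yields the second
      component 0.\<close>
    then have "\<gamma> \<in> T" "conflate \<gamma> \<in> T"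
      using T(2) pr_derives.premise pr_derives.conf unfolding D_def by blast+
    then show "outer_val vp vm P \<gamma> = (1, 0)"
      using val in_F[of \<gamma>] \<open>\<gamma> \<in> \<Gamma>\<close> emb.val_designated by simp
  next
    show "outer_val vp vm P \<alpha> \<noteq> (1, 0)"
      using val in_F[of \<alpha>] emb.val_not_designated T(3) by simp
  qed
qed

theorem mainTheorem8:
  fixes \<Gamma> :: "'p outer set" and \<alpha> :: "'p outer"
  assumes "finite (\<Gamma> \<union> {\<alpha>})"
  shows "pr_derives \<Gamma> \<alpha> \<longleftrightarrow> pr_entails TYPE('w::infinite) \<Gamma> \<alpha>"
proof
  assume "pr_derives \<Gamma> \<alpha>"
  then show "pr_entails TYPE('w) \<Gamma> \<alpha>"
    unfolding pr_entails_def using pr_derives_sound by blast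
next
  assume entails: "pr_entails TYPE('w) \<Gamma> \<alpha>"
  show "pr_derives \<Gamma> \<alpha>"
  proof (rule ccontr)
    assume not: "\<not> pr_derives \<Gamma> \<alpha>"
    have "finite \<Gamma>" using assms by simp
    from countermodel[OF this not] obtain W :: "'w set" and vp vm P where "prob_bd_model W vp vm P"
      "\<And>\<gamma>. \<gamma> \<in> \<Gamma> \<Longrightarrow> outer_val vp vm P \<gamma> = (1, 0)" "outer_val vp vm P \<alpha> \<noteq> (1, 0)"
      by blast
    then show False using entails unfolding pr_entails_def by blast
  qed
qed

end
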